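(* For $\lambda\in\mathbb{C}$ with $\Im(\lambda)>0$ let $f_\lambda(z)=\lambda+z+\tan z$ and let $B$ be its primary Fatou component. (1) If $0<\Im(\lambda)<1$, then the Fatou set of $f_\lambda$ contains an invariant Baker domain $\tilde B$ different from $B$. Further, if $\Re(\lambda)=k\pi$ for some integer $k$, then $\tilde B$ is the only Fatou component of $f_\lambda$ different from $B$, and the Julia set of $f_\lambda$ is connected. (2) If $\Im(\lambda)>\sqrt{2}+\sinh^{-1}1$, then $B$ is the only Fatou component of $f_\lambda$ and the Julia set of $f_\lambda$ is not connected.
   Context: For a transcendental meromorphic function $f:\mathbb{C}\to\widehat{\mathbb{C}}$, the Fatou set $\mathcal{F}(f)$ is the set of points having a neighborhood on which all iterates $f^n$, $n>0$, are defined and form a normal family; the Julia set $\mathcal{J}(f)$ is its complement in $\widehat{\mathbb{C}}$ (so $\infty\in\mathcal{J}(f)$). A Fatou component is a maximal connected subset of $\mathcal{F}(f)$. A Fatou component $U$ is invariant if $f(U)\subseteq U$, and completely invariant if moreover $f^{-1}(U)\subseteq U$. An invariant Fatou component $U$ is a Baker domain if $f^n\to\infty$ uniformly on every compact subset of $U$. For $\Im(\lambda)>0$, the function $f_\lambda$ has a completely invariant Baker domain containing the upper half-plane $\{z:\Im(z)>0\}$; it is called the primary Fatou component and is denoted by $B$. *)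

theory Defs
  imports "HOL-Analysis.Analysis"
begin

text \<open>
  Points of the Riemann sphere are elements of \<^typ>\<open>complex option\<close>, with \<^term>\<open>None\<close> as
  the point at infinity; its topology is the one-point compactification of the plane.
\<close>

abbreviation riemann_sphere :: "complex option topology" where
  "riemann_sphere \<equiv> Alexandroff_compactification euclidean"

text \<open>
  Inverse stereographic projection onto the unit sphere of \<^typ>\<open>complex \<times> real\<close>.  The
  Euclidean distance of two image points is the chordal (spherical) distance of the two points,
  so uniform convergence in the spherical metric is \<^const>\<open>uniform_limit\<close> after composition
  with this map.
\<close>

fun stereo :: "complex option \<Rightarrow> complex \<times> real" where
  "stereo (Some z) =
     ((2 / (1 + (cmod z)\<^sup>2)) *\<^sub>R z, ((cmod z)\<^sup>2 - 1) / ((cmod z)\<^sup>2 + 1))"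
| "stereo None = (0, 1)"

definition sphere_uniform_limit ::
    "complex set \<Rightarrow> (nat \<Rightarrow> complex \<Rightarrow> complex option) \<Rightarrow> (complex \<Rightarrow> complex option) \<Rightarrow> bool" where
  "sphere_uniform_limit K F g \<longleftrightarrow>
     uniform_limit K (\<lambda>n z. stereo (F n z)) (\<lambda>z. stereo (g z)) sequentially"

definition normal_family_on :: "complex set \<Rightarrow> (complex \<Rightarrow> complex option) set \<Rightarrow> bool" where
  "normal_family_on V \<F> \<longleftrightarrow>
     (\<forall>F :: nat \<Rightarrow> complex \<Rightarrow> complex option. range F \<subseteq> \<F> \<longrightarrow>
        (\<exists>r g. strict_mono (r :: nat \<Rightarrow> nat) \<and>
               (\<forall>K. compact K \<and> K \<subseteq> V \<longrightarrow> sphere_uniform_limit K (\<lambda>n. F (r n)) g)))"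

text \<open>
  Iterates of a map from the plane to the sphere.  The map is not defined at infinity, so an orbit
  stops when it reaches infinity; \<^term>\<open>None\<close> then also stands for an undefined value, and
  the iterate of order \<open>n + 1\<close> is defined at \<open>z\<close> iff the iterate of order \<open>n\<close> is finite there.
\<close>

primrec iter :: "(complex \<Rightarrow> complex option) \<Rightarrow> nat \<Rightarrow> complex \<Rightarrow> complex option" where
  "iter f 0 z = Some z"
| "iter f (Suc n) z = Option.bind (iter f n z) f"

definition all_iterates_defined_on :: "(complex \<Rightarrow> complex option) \<Rightarrow> complex set \<Rightarrow> bool" where
  "all_iterates_defined_on f V \<longleftrightarrow> (\<forall>z\<in>V. \<forall>n. iter f n z \<noteq> None)"

text \<open>Infinity never belongs to the Fatou set, which is therefore a set of complex numbers.\<close>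

definition fatou_set :: "(complex \<Rightarrow> complex option) \<Rightarrow> complex set" where
  "fatou_set f =
     {z. \<exists>V. open V \<and> z \<in> V \<and> all_iterates_defined_on f V \<and>
             normal_family_on V {iter f n |n. n > 0}}"

definition julia_set :: "(complex \<Rightarrow> complex option) \<Rightarrow> complex option set" where
  "julia_set f = UNIV - Some ` fatou_set f"

abbreviation fatou_components :: "(complex \<Rightarrow> complex option) \<Rightarrow> complex set set" where
  "fatou_components f \<equiv> components (fatou_set f)"

definition invariant :: "(complex \<Rightarrow> complex option) \<Rightarrow> complex set \<Rightarrow> bool" where
  "invariant f U \<longleftrightarrow> f ` U \<subseteq> Some ` U"

definition completely_invariant :: "(complex \<Rightarrow> complex option) \<Rightarrow> complex set \<Rightarrow> bool" where
  "completely_invariant f U \<longleftrightarrow> invariant f U \<and> f -` (Some ` U) \<subseteq> U"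

definition invariant_baker_domain :: "(complex \<Rightarrow> complex option) \<Rightarrow> complex set \<Rightarrow> bool" where
  "invariant_baker_domain f U \<longleftrightarrow>
     U \<in> fatou_components f \<and> invariant f U \<and>
     (\<forall>K. compact K \<and> K \<subseteq> U \<longrightarrow> sphere_uniform_limit K (iter f) (\<lambda>_. None))"

text \<open>In HOL \<^term>\<open>tan z = 0\<close> where \<^term>\<open>cos z = 0\<close>, so the poles are treated separately.\<close>

definition tan_map :: "complex \<Rightarrow> complex \<Rightarrow> complex option" where
  "tan_map lam z = (if cos z = 0 then None else Some (lam + z + tan z))"

text \<open>
  Distinct Fatou components are disjoint, so at most one contains the upper half-plane.  The
  primary Fatou component is identified by this property alone; that it is moreover a completely
  invariant Baker domain is a theorem about it, not part of the definition.  By the lemma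
  \<open>primary_component_unique\<close>, it is the only candidate for a completely invariant Baker domain
  containing the upper half-plane.
\<close>

definition primary_component :: "complex \<Rightarrow> complex set" where
  "primary_component lam =
     (THE U. U \<in> fatou_components (tan_map lam) \<and> {z. Im z > 0} \<subseteq> U)"

lemma primary_component_eqI:
  assumes "U \<in> fatou_components (tan_map lam)" and "{z. Im z > 0} \<subseteq> U"
  shows "primary_component lam = U"
  unfolding primary_component_def
proof (rule the_equality)
  fix V assume V: "V \<in> fatou_components (tan_map lam) \<and> {z. Im z > 0} \<subseteq> V"
  have "\<i> \<in> {z. Im z > 0}" by simp
  then have "\<i> \<in> U \<inter> V" using assms(2) V by blast
  then show "V = U" using assms(1) V components_nonoverlap by blast
qed (use assms in blast)

lemma primary_component_unique:
  assumes "invariant_baker_domain (tan_map lam) U" and "completely_invariant (tan_map lam) U"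
    and "{z. Im z > 0} \<subseteq> U"
  shows "primary_component lam = U"
  using assms by (intro primary_component_eqI) (auto simp: invariant_baker_domain_def)

end

(*
  f = tan_map lam commutes with the translation by pi, and {Im z > 0} is forward invariant with Im
  z increasing by at least Im lam. The same holds for {Im z < -M}, with Im z decreasing, if Im lam
  < tanh M. Let A+ and A- be the open sets of points whose orbits enter these half-planes.

  If all iterates are defined on a connected open set V, then they omit the poles there, and
  Schottky's theorem shows that V lies in A+ or is disjoint from it; likewise for A-. A+ is always
  connected, and so is A- if Re lam is a multiple of pi.

  In both cases with a description of all Fatou components, no other points have a neighbourhood
  on which all iterates are defined, because f is expanding elsewhere. For Im lam > sqrt 2 +
  arsinh 1 the critical values lie in the upper half-plane, and f expands the hyperbolic metric of
  the lower half-plane. If Re lam is a multiple of pi and Im lam < 1, the region where |f'| <= 1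
  in the lower half-plane lies in A-, and f expands the Euclidean metric off A-. By the
  Schwarz-Pick lemma this expansion is incompatible with iterates avoiding A+ and A-.

  Preimages of poles are dense in the Julia set, so in the case of two components the finite part
  of the Julia set is the intersection of the closures of A+ and A-, and is connected because the
  plane is unicoherent. In the case of one component, A+ contains a frame around a pole.
*)

theory Submission
  imports Defs "HOL-Complex_Analysis.Complex_Analysis"
begin

subsection \<open>Real inequalities and the complex tangent\<close>

text \<open>Two properties of \<open>tan\<close> fix the constants of the theorem. Far below the
  real axis the imaginary part of \<open>tan\<close> is close to -1, so one step of f moves points
  down by nearly 1 - Im lam; this is where Im lam < 1 enters. The critical points are the solutions
  of (cos z)^2 = -1. Those in the lower half-plane have imaginary part - arsinh 1, and
  \<open>tan\<close> has imaginary part - sqrt 2 there, so their images lie above the real axis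
  exactly if Im lam > sqrt 2 + arsinh 1. The obstacle to connectedness of a basin is that f is not
  proper: a component of a preimage need not be mapped onto its target, since preimages of a bounded
  set accumulate at infinity. This is controlled by the fact that f has the same shape at all its
  poles, so one local inverse serves for all of them. The expansion is not uniform by itself. For
  large Im lam it weakens far below the real axis, and orbits have to be brought back infinitely
  often; for Im lam < 1 uniformity comes from compactness modulo translation by pi.\<close>

lemma Re_cos_cosh: "Re (cos z) = cos (Re z) * cosh (Im z)"
  by (simp add: Re_cos cosh_def)

lemma Im_cos_sinh: "Im (cos z) = - sin (Re z) * sinh (Im z)"
  by (simp add: Im_cos sinh_def field_simps)

lemma Re_sin_cosh: "Re (sin z) = sin (Re z) * cosh (Im z)"
  by (simp add: Re_sin cosh_def)

lemma Im_sin_sinh: "Im (sin z) = cos (Re z) * sinh (Im z)"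
  by (simp add: Im_sin sinh_def)

text \<open>The sum on the right is the common denominator of the real and imaginary parts of
  \<open>tan\<close>; it vanishes exactly at the poles.\<close>

lemma cmod_cos_squared: "(cmod (cos z))\<^sup>2 = (cos (2 * Re z) + cosh (2 * Im z)) / 2"
proof -
  have s: "(sin (Re z))\<^sup>2 = 1 - (cos (Re z))\<^sup>2" by (simp add: sin_squared_eq)
  have c: "(sinh (Im z))\<^sup>2 = (cosh (Im z))\<^sup>2 - 1" by (simp add: sinh_square_eq)
  show ?thesis
    unfolding cmod_power2 Re_cos_cosh Im_cos_sinh power_mult_distrib power2_minus s c
      cos_double_cos cosh_double_cosh
    by algebra
qed

lemma cos_plus_cosh_pos: "cos z \<noteq> 0 \<Longrightarrow> cos (2 * Re z) + cosh (2 * Im z) > 0" for z :: complex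
  using cmod_cos_squared[of z] by (metis half_gt_zero_iff zero_less_norm_iff zero_less_power)

lemma tan_complex_parts:
  assumes "cos z \<noteq> 0"
  shows "Re (tan z) = sin (2 * Re z) / (cos (2 * Re z) + cosh (2 * Im z))"
    and "Im (tan z) = sinh (2 * Im z) / (cos (2 * Re z) + cosh (2 * Im z))"
proof -
  define q where "q = cos (2 * Re z) + cosh (2 * Im z)"
  have q: "q > 0" using cos_plus_cosh_pos[OF assms] by (simp add: q_def)
  have n: "(cmod (cos z))\<^sup>2 = q / 2" by (simp add: cmod_cos_squared q_def)
  have s: "(sin (Re z))\<^sup>2 = 1 - (cos (Re z))\<^sup>2" by (simp add: sin_squared_eq)
  have c: "(cosh (Im z))\<^sup>2 = (sinh (Im z))\<^sup>2 + 1" by (simp add: cosh_square_eq)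
  have t: "tan z = (2 / q) *\<^sub>R (sin z * cnj (cos z))"
    unfolding tan_def using q
    by (subst complex_div_cnj) (simp add: n scaleR_conv_of_real field_simps)
  have "Re (sin z * cnj (cos z)) =
      sin (Re z) * cos (Re z) * ((cosh (Im z))\<^sup>2 - (sinh (Im z))\<^sup>2)"
    by (simp add: Re_cos_cosh Im_cos_sinh Re_sin_cosh Im_sin_sinh power2_eq_square algebra_simps)
  also have "\<dots> = sin (2 * Re z) / 2" by (simp add: c sin_double)
  finally show "Re (tan z) = sin (2 * Re z) / (cos (2 * Re z) + cosh (2 * Im z))"
    using t q by (simp add: q_def field_simps)
  have "Im (sin z * cnj (cos z)) =
      sinh (Im z) * cosh (Im z) * ((cos (Re z))\<^sup>2 + (sin (Re z))\<^sup>2)"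
    unfolding Re_cos_cosh Im_cos_sinh Re_sin_cosh Im_sin_sinh times_complex.simps cnj.simps
      complex.sel
    by algebra
  also have "\<dots> = sinh (2 * Im z) / 2" by (simp add: sinh_double)
  finally show "Im (tan z) = sinh (2 * Im z) / (cos (2 * Re z) + cosh (2 * Im z))"
    using t q by (simp add: q_def field_simps)
qed

lemma cosh_double_gt_one: "y \<noteq> 0 \<Longrightarrow> cosh (2 * y) > 1" for y :: real
  by (simp add: cosh_double cosh_square_eq)

lemma cos_complex_nonzero:
  assumes "Im z \<noteq> 0"
  shows "cos z \<noteq> 0"
proof
  assume "cos z = 0"
  then have "cos (2 * Re z) + cosh (2 * Im z) = 0" using cmod_cos_squared[of z] by simp
  with cosh_double_gt_one[OF assms] cos_ge_minus_one[of "2 * Re z"] show False by linarith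
qed

lemma sin_cos_complex_of_int_pi:
  fixes z :: complex
  shows "cos (z + of_int m * of_real pi) = (if even m then cos z else - cos z)"
    and "sin (z + of_int m * of_real pi) = (if even m then sin z else - sin z)"
proof -
  have "cos (of_int m * of_real pi) = (if even m then 1 else - 1 :: complex)"
    and "sin (of_int m * of_real pi) = (0 :: complex)"
    unfolding cos_int_times_real sin_int_times_real
    using cos_npi_int[of m] sin_npi_int[of m] by (simp_all add: mult.commute)
  then show "cos (z + of_int m * of_real pi) = (if even m then cos z else - cos z)"
    and "sin (z + of_int m * of_real pi) = (if even m then sin z else - sin z)"
    by (simp_all add: cos_add sin_add)
qed

lemma tan_complex_of_int_pi: "tan (z + of_int m * of_real pi) = tan z" for z :: complex
  by (simp add: tan_def sin_cos_complex_of_int_pi)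

lemma sin_cos_double_of_int_pi:
  fixes x :: real
  shows "cos (2 * (x - of_int m * pi)) = cos (2 * x)"
    and "sin (2 * (x - of_int m * pi)) = sin (2 * x)"
  using cos_int_2pin[of m] sin_int_2pin[of m]
  by (simp_all add: cos_diff sin_diff right_diff_distrib mult_ac)

lemma cos_half_pi_plus_of_int_pi: "cos (of_real (pi / 2 + of_int m * pi) :: complex) = 0"
  using sin_cos_complex_of_int_pi(1)[of "of_real (pi / 2)" m] by (simp add: cos_of_real del: of_real_divide)

lemma nearest_of_int_pi:
  fixes x c :: real
  obtains m :: int where "\<bar>x - c - of_int m * pi\<bar> \<le> pi / 2"
proof
  have "\<bar>of_int (round ((x - c) / pi)) - (x - c) / pi\<bar> * pi \<le> 1 / 2 * pi"
    by (intro mult_right_mono of_int_round_abs_le) auto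
  also have "\<bar>of_int (round ((x - c) / pi)) - (x - c) / pi\<bar> * pi
      = \<bar>(of_int (round ((x - c) / pi)) - (x - c) / pi) * pi\<bar>" by (simp add: abs_mult)
  also have "(of_int (round ((x - c) / pi)) - (x - c) / pi) * pi
      = - (x - c - of_int (round ((x - c) / pi)) * pi)" by (simp add: field_simps)
  finally show "\<bar>x - c - of_int (round ((x - c) / pi)) * pi\<bar> \<le> pi / 2"
    by (simp only: abs_minus_cancel)
qed

section \<open>Inequalities for real hyperbolic functions\<close>

lemma coth_decreasing:
  fixes x y :: real
  assumes "0 < x" "x \<le> y"
  shows "cosh y / sinh y \<le> cosh x / sinh x"
proof -
  have "sinh (y - x) \<ge> 0" using assms by simp
  then have "cosh y * sinh x \<le> cosh x * sinh y" by (simp add: sinh_diff algebra_simps)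
  then show ?thesis using assms by (simp add: frac_le_eq divide_simps mult_ac)
qed

text \<open>These are the imaginary parts of \<open>tan\<close> at height y on the vertical lines
  through its zeros and through its poles. For y > 0 they are the smallest and the largest value at
  that height.\<close>

lemma sinh_double_over_cosh_double:
  fixes y :: real
  shows "sinh (2 * y) / (1 + cosh (2 * y)) = tanh y"
    and "y \<noteq> 0 \<Longrightarrow> sinh (2 * y) / (cosh (2 * y) - 1) = cosh y / sinh y"
proof -
  have h: "1 + cosh (2 * y) = 2 * (cosh y)\<^sup>2" by (simp add: cosh_double_cosh)
  show "sinh (2 * y) / (1 + cosh (2 * y)) = tanh y"
    unfolding h sinh_double tanh_def by (simp add: power2_eq_square)
  have h: "cosh (2 * y) - 1 = 2 * (sinh y)\<^sup>2" by (simp add: cosh_double cosh_square_eq)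
  show "y \<noteq> 0 \<Longrightarrow> sinh (2 * y) / (cosh (2 * y) - 1) = cosh y / sinh y"
    unfolding h sinh_double by (simp add: power2_eq_square)
qed

text \<open>Needed at the end point \<open>q = H - 1\<close> of
  \<open>half_plane_expansion_real\<close>, for sinh y >= 1. The difference \<open>r\<close>
  vanishes at arsinh 1 by the choice of \<open>L\<close>, and half its derivative is cosh x * (L *
  sinh x - cosh x), which is nonnegative because cosh x <= sqrt 2 * sinh x from there on.\<close>

lemma endpoint_inequality_large:
  fixes y :: real
  defines "L \<equiv> sqrt 2 + arsinh 1"
  assumes "arsinh 1 \<le> y"
  shows "y + sinh y * cosh y \<le> L * (sinh y)\<^sup>2"
proof -
  define r where "r = (\<lambda>y::real. L * (sinh y)\<^sup>2 - y - sinh y * cosh y)"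
  have "r (arsinh 1) \<le> r y"
  proof (rule DERIV_nonneg_imp_nondecreasing[OF assms(2)])
    fix x :: real assume x: "arsinh 1 \<le> x" "x \<le> y"
    have s: "sinh x \<ge> 1" using x by (metis sinh_arsinh_real sinh_real_le_iff)
    then have "(sinh x)\<^sup>2 \<ge> 1" by simp
    then have "(cosh x)\<^sup>2 \<le> (sqrt 2 * sinh x)\<^sup>2"
      by (simp add: cosh_square_eq power_mult_distrib)
    then have "cosh x \<le> sqrt 2 * sinh x" 
      by (rule power2_le_imp_le) (intro mult_nonneg_nonneg, simp, use s in linarith)
    also have "\<dots> \<le> L * sinh x" 
      unfolding L_def
      by (rule mult_right_mono, simp add: less_imp_le, use s in linarith)
    finally have "cosh x * cosh x \<le> L * sinh x * cosh x" by (rule mult_right_mono) simp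
    then have "0 \<le> 2 * L * sinh x * cosh x - 1 - ((cosh x)\<^sup>2 + (sinh x)\<^sup>2)"
      using cosh_square_eq[of x] unfolding power2_eq_square by linarith
    moreover have "(r has_real_derivative (2 * L * sinh x * cosh x - 1 - ((cosh x)\<^sup>2 + (sinh x)\<^sup>2))) (at x)"
      unfolding r_def by (auto intro!: derivative_eq_intros simp: power2_eq_square)
    ultimately show "\<exists>d. (r has_real_derivative d) (at x) \<and> d \<ge> 0" by blast
  qed
  moreover have "r (arsinh 1) = 0" by (simp add: r_def L_def cosh_arsinh_real)
  ultimately show ?thesis by (simp add: r_def)
qed

text \<open>The same end point for sinh y <= 1. On positive arguments the derivative of
  \<open>r\<close> has the sign of the decreasing function \<open>k\<close>, so \<open>r\<close> can
  only rise and then fall; as it vanishes at 0 and at arsinh 1, it is nonnegative in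
  between.\<close>

lemma endpoint_inequality_small:
  fixes y :: real
  defines "L \<equiv> sqrt 2 + arsinh 1"
  assumes "0 < y" "y \<le> arsinh 1"
  shows "2 * y * (sinh y)\<^sup>2 + sinh y * cosh y \<le> y + L * (sinh y)\<^sup>2"
proof -
  define r where "r = (\<lambda>y::real. y + L * (sinh y)\<^sup>2 - 2 * y * (sinh y)\<^sup>2 - sinh y * cosh y)"
  define k where "k = (\<lambda>y::real. L - 2 * y - 2 * tanh y)"
  have k_eq: "2 * sinh x * cosh x * k x = 2 * sinh x * ((L - 2 * x) * cosh x - 2 * sinh x)" for x
    by (simp add: k_def tanh_def field_simps)
  have k_eq': "2 * sinh x * cosh x * k x = 1 + 2 * L * sinh x * cosh x - 2 * (sinh x)\<^sup>2
        - 4 * x * sinh x * cosh x - ((cosh x)\<^sup>2 + (sinh x)\<^sup>2)" for x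
    unfolding k_eq cosh_square_eq by algebra
  have deriv: "(r has_real_derivative (2 * sinh x * cosh x * k x)) (at x)" for x
    unfolding r_def k_eq' by (auto intro!: derivative_eq_intros simp: power2_eq_square)
  have k_anti: "k b \<le> k a" if "a \<le> b" for a b
  proof -
    have "tanh a \<le> tanh b" using that by simp
    with that show ?thesis unfolding k_def by linarith
  qed
  have "r y \<ge> 0"
  proof (cases "k y \<ge> 0")
    case True
    have "r 0 \<le> r y"
    proof (rule DERIV_nonneg_imp_nondecreasing[where f = r])
      fix x assume x: "0 \<le> x" "x \<le> y"
      then have "k x \<ge> 0" using k_anti[of x y] True by linarith
      then show "\<exists>d. (r has_real_derivative d) (at x) \<and> d \<ge> 0" using deriv[of x] x by auto
    qed (use assms in simp)
    then show ?thesis by (simp add: r_def)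
  next
    case False
    have "r y \<ge> r (arsinh 1)"
    proof (rule DERIV_nonpos_imp_nonincreasing[where f = r])
      fix x assume x: "y \<le> x" "x \<le> arsinh 1"
      then have "k x \<le> 0" using k_anti[of y x] False by linarith
      then have "2 * sinh x * cosh x * k x \<le> 0"
        using x assms by (intro mult_nonneg_nonpos) auto
      then show "\<exists>d. (r has_real_derivative d) (at x) \<and> d \<le> 0" using deriv[of x] by auto
    qed (use assms in simp)
    moreover have "r (arsinh 1) = 0" by (simp add: r_def L_def cosh_arsinh_real)
    ultimately show ?thesis by simp
  qed
  then show ?thesis by (simp add: r_def)
qed

text \<open>Concavity comes down to s * t + b^2 <= x * y, the Cauchy-Schwarz inequality for the
  vectors (s, b) and (t, b), whose lengths are x and y.\<close>

lemma concave_sqrt_hyperbola: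
  fixes x y b u :: real
  assumes "\<bar>b\<bar> \<le> x" "\<bar>b\<bar> \<le> y" "0 \<le> u" "u \<le> 1"
  shows "(1 - u) * sqrt (x\<^sup>2 - b\<^sup>2) + u * sqrt (y\<^sup>2 - b\<^sup>2) \<le> sqrt (((1 - u) * x + u * y)\<^sup>2 - b\<^sup>2)"
proof -
  define s t where "s = sqrt (x\<^sup>2 - b\<^sup>2)" and "t = sqrt (y\<^sup>2 - b\<^sup>2)"
  have s: "s\<^sup>2 = x\<^sup>2 - b\<^sup>2" "s \<ge> 0" and t: "t\<^sup>2 = y\<^sup>2 - b\<^sup>2" "t \<ge> 0"
    using assms(1,2) abs_le_square_iff[of b x] abs_le_square_iff[of b y] by (auto simp: s_def t_def)
  have "(s * t + b\<^sup>2)\<^sup>2 \<le> (x * y)\<^sup>2"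
  proof -
    have "(x * y)\<^sup>2 - (s * t + b\<^sup>2)\<^sup>2 = (s\<^sup>2 + b\<^sup>2) * (t\<^sup>2 + b\<^sup>2) - (s * t + b\<^sup>2)\<^sup>2"
      by (simp add: s t power_mult_distrib)
    also have "\<dots> = b\<^sup>2 * (s - t)\<^sup>2" by (simp add: power2_eq_square algebra_simps)
    finally show ?thesis by (smt (verit) zero_le_mult_iff zero_le_power2)
  qed
  moreover have "x * y \<ge> 0" using assms(1,2) by (intro mult_nonneg_nonneg) linarith+
  ultimately have "s * t + b\<^sup>2 \<le> x * y" by (rule power2_le_imp_le)
  then have c: "u * (1 - u) * (s * t + b\<^sup>2) \<le> u * (1 - u) * (x * y)"
    using assms(3,4) by (intro mult_left_mono mult_nonneg_nonneg) auto
  have "((1 - u) * s + u * t)\<^sup>2 = (1 - u)\<^sup>2 * (x\<^sup>2 - b\<^sup>2) + u\<^sup>2 * (y\<^sup>2 - b\<^sup>2) + 2 * (u * (1 - u) * (s * t))"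
    unfolding power2_sum power_mult_distrib s t by algebra
  also have "\<dots> = ((1 - u) * x + u * y)\<^sup>2 - b\<^sup>2 - 2 * (u * (1 - u) * (x * y) - u * (1 - u) * (s * t + b\<^sup>2))"
    by algebra
  also have "\<dots> \<le> ((1 - u) * x + u * y)\<^sup>2 - b\<^sup>2" using c by simp
  finally show ?thesis unfolding s_def t_def by (rule real_le_rsqrt)
qed

text \<open>
  The right-hand side is concave and the left-hand side affine in \<open>q\<close>, so only the end points
  matter.  At \<open>q = H - 1\<close> and \<open>sinh y = 1\<close> there is equality, which is where the constant
  \<open>sqrt 2 + arsinh 1\<close> comes from.
\<close>

lemma half_plane_expansion_real:
  fixes y q :: real
  defines "H \<equiv> cosh (2 * y)" and "S \<equiv> sinh (2 * y)" and "L \<equiv> sqrt 2 + arsinh 1"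
  assumes y: "0 < y" and q: "H - 1 \<le> q" "q \<le> H + 1"
  shows "(y - L) * q + S \<le> y * sqrt ((q + 2 * H)\<^sup>2 - 8 * S\<^sup>2)"
proof -
  define u where "u = (q - (H - 1)) / 2"
  have u: "0 \<le> u" "u \<le> 1" "q = (1 - u) * (H - 1) + u * (H + 1)"
    using q by (auto simp: u_def field_simps)
  define b where "b = sqrt 8 * S"
  have b2: "b\<^sup>2 = 8 * S\<^sup>2" by (simp add: b_def power_mult_distrib)
  have SH: "S\<^sup>2 = H\<^sup>2 - 1" by (simp add: S_def H_def sinh_square_eq)
  have H1: "H \<ge> 1" by (simp add: H_def cosh_real_ge_1)
  define s where "s = sinh y"
  have Hs: "H = 1 + 2 * s\<^sup>2" by (simp add: H_def s_def cosh_double cosh_square_eq)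
  have Sc: "S = 2 * s * cosh y" by (simp add: S_def s_def sinh_double)
  have s0: "s > 0" using y by (simp add: s_def)
  \<comment> \<open>At both end values of \<open>q\<close> the radicand is a perfect square, so the
    root disappears there.\<close>
  have e1: "(3 * H - 1)\<^sup>2 - b\<^sup>2 = (H - 3)\<^sup>2"
    unfolding b2 SH by algebra
  have e2: "(3 * H + 1)\<^sup>2 - b\<^sup>2 = (H + 3)\<^sup>2"
    unfolding b2 SH by algebra
  have x1: "\<bar>b\<bar> \<le> 3 * H - 1" using e1 H1 abs_le_square_iff[of b "3 * H - 1"] zero_le_power2[of "H - 3"] by linarith
  have x2: "\<bar>b\<bar> \<le> 3 * H + 1" using x1 by linarith
  have left: "(y - L) * (H - 1) + S \<le> y * \<bar>H - 3\<bar>"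
  proof (cases "arsinh 1 \<le> y")
    case True
    then have "s \<ge> 1" unfolding s_def by (metis sinh_arsinh_real sinh_real_le_iff)
    then have "s\<^sup>2 \<ge> 1" by simp
    then have "\<bar>H - 3\<bar> = 2 * s\<^sup>2 - 2" by (simp add: Hs)
    then show ?thesis using endpoint_inequality_large[OF True] 
      by (simp add: Hs Sc s_def L_def algebra_simps)
  next
    case False
    then have "s < 1" unfolding s_def by (metis not_le sinh_arsinh_real sinh_real_le_iff)
    then have "s\<^sup>2 \<le> 1" using s0 by (simp add: power_le_one)
    then have "\<bar>H - 3\<bar> = 2 - 2 * s\<^sup>2" by (simp add: Hs)
    then show ?thesis using endpoint_inequality_small[of y] False y 
      by (simp add: Hs Sc s_def L_def algebra_simps)
  qed
  have right: "(y - L) * (H + 1) + S \<le> y * (H + 3)"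
  proof -
    have "sqrt 2 \<ge> 1" "arsinh (1 :: real) > 0" by simp_all
    then have "L \<ge> 1" unfolding L_def by linarith
    then have "1 * (H + 1) \<le> L * (H + 1)" using H1 by (intro mult_right_mono) auto
    moreover have "S \<le> H" by (simp add: S_def H_def sinh_le_cosh_real)
    ultimately show ?thesis using y by (simp add: algebra_simps)
  qed
  have "(y - L) * q + S = (1 - u) * ((y - L) * (H - 1) + S) + u * ((y - L) * (H + 1) + S)"
    unfolding u(3) by algebra
  also have "\<dots> \<le> (1 - u) * (y * \<bar>H - 3\<bar>) + u * (y * (H + 3))"
    using u left right by (intro add_mono mult_left_mono) auto
  also have "\<dots> = y * ((1 - u) * sqrt ((3 * H - 1)\<^sup>2 - b\<^sup>2) + u * sqrt ((3 * H + 1)\<^sup>2 - b\<^sup>2))"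
  proof -
    have "sqrt ((3 * H - 1)\<^sup>2 - b\<^sup>2) = \<bar>H - 3\<bar>" "sqrt ((3 * H + 1)\<^sup>2 - b\<^sup>2) = H + 3"
      unfolding e1 e2 using H1 by simp_all
    then show ?thesis by (simp only: distrib_left mult.left_commute)
  qed
  also have "\<dots> \<le> y * sqrt (((1 - u) * (3 * H - 1) + u * (3 * H + 1))\<^sup>2 - b\<^sup>2)"
    using y u x1 x2 by (intro mult_left_mono concave_sqrt_hyperbola) auto
  also have "(1 - u) * (3 * H - 1) + u * (3 * H + 1) = q + 2 * H"
    unfolding u(3) by algebra
  finally show ?thesis unfolding b2 .
qed

subsection \<open>Iterates and basins\<close>

text \<open>A total version of f. At a pole its value \<open>lam + z\<close> is meaningless, so
  iterates are trusted only together with \<open>regular\<close>.\<close>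

definition tan_shift :: "complex \<Rightarrow> complex \<Rightarrow> complex" where
  "tan_shift lam z = lam + z + tan z"

text \<open>Only the first n points of the orbit are constrained: the n-th iterate is then finite,
  but may itself be a pole.\<close>

definition regular :: "complex \<Rightarrow> nat \<Rightarrow> complex \<Rightarrow> bool" where
  "regular lam n z \<longleftrightarrow> (\<forall>k<n. cos ((tan_shift lam ^^ k) z) \<noteq> 0)"

definition basin :: "complex \<Rightarrow> complex set \<Rightarrow> complex set" where
  "basin lam S = {z. \<exists>n. regular lam n z \<and> (tan_shift lam ^^ n) z \<in> S}"

lemma regular_0 [simp]: "regular lam 0 z"
  by (simp add: regular_def)

lemma regular_Suc: "regular lam (Suc n) z \<longleftrightarrow> regular lam n z \<and> cos ((tan_shift lam ^^ n) z) \<noteq> 0"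
  by (auto simp: regular_def less_Suc_eq)

lemma regular_Suc_left:
  "regular lam (Suc n) z \<longleftrightarrow> cos z \<noteq> 0 \<and> regular lam n (tan_shift lam z)"
  unfolding regular_def All_less_Suc2 funpow_Suc_right by simp

lemma regular_mono: "m \<le> n \<Longrightarrow> regular lam n z \<Longrightarrow> regular lam m z"
  by (auto simp: regular_def)

lemma funpow_add_apply: "(f ^^ (m + n)) z = (f ^^ n) ((f ^^ m) z)"
  by (metis add.commute comp_apply funpow_add)

lemma regular_add:
  "regular lam m z \<Longrightarrow> regular lam n ((tan_shift lam ^^ m) z) \<Longrightarrow> regular lam (m + n) z"
proof (induction n)
  case (Suc n)
  then show ?case by (simp add: regular_Suc funpow_add_apply)
qed simp

lemma iter_tan_map:
  "iter (tan_map lam) n z = (if regular lam n z then Some ((tan_shift lam ^^ n) z) else None)"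
  by (induction n) (auto simp: regular_Suc tan_map_def tan_shift_def[of lam "(tan_shift lam ^^ _) z"])

lemma fatou_set_regular: "z \<in> fatou_set (tan_map lam) \<Longrightarrow>
    \<exists>V. open V \<and> z \<in> V \<and> V \<subseteq> fatou_set (tan_map lam) \<and> (\<forall>w\<in>V. \<forall>n. regular lam n w)"
  unfolding fatou_set_def all_iterates_defined_on_def iter_tan_map
  by (clarsimp split: if_splits) blast

lemma tan_shift_has_field_derivative:
  "cos z \<noteq> 0 \<Longrightarrow> (tan_shift lam has_field_derivative (1 + 1 / (cos z)\<^sup>2)) (at z within X)"
  unfolding tan_shift_def[abs_def]
  by (auto intro!: derivative_eq_intros simp: field_simps)

lemma closed_cos_zeros: "closed {z :: complex. cos z = 0}"
  by (intro closed_Collect_eq continuous_intros)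

lemma open_cos_nonzero: "open {z :: complex. cos z \<noteq> 0}"
  using closed_cos_zeros by (simp add: closed_def Compl_eq)

lemma tan_shift_holomorphic: "tan_shift lam holomorphic_on {z. cos z \<noteq> 0}"
  using tan_shift_has_field_derivative by (auto simp: holomorphic_on_def field_differentiable_def)

lemma tan_shift_funpow:
  "open {z. regular lam n z} \<and> (tan_shift lam ^^ n) holomorphic_on {z. regular lam n z}"
proof (induction n)
  case (Suc n)
  have *: "{z. regular lam (Suc n) z} = {z \<in> {z. regular lam n z}. (tan_shift lam ^^ n) z \<in> {z. cos z \<noteq> 0}}"
    by (auto simp: regular_Suc)
  have "open {z. regular lam (Suc n) z}"
    unfolding * using Suc[THEN conjunct1]
      continuous_open_preimage[OF holomorphic_on_imp_continuous_on[OF Suc[THEN conjunct2]] _ open_cos_nonzero]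
    by (simp add: Int_def vimage_def)
  moreover have "(tan_shift lam \<circ> (tan_shift lam ^^ n)) holomorphic_on {z. regular lam (Suc n) z}"
    using Suc by (intro holomorphic_on_compose_gen[OF _ tan_shift_holomorphic])
      (auto simp: regular_Suc intro: holomorphic_on_subset)
  ultimately show ?case by (simp add: o_def)
qed auto

lemmas open_regular = tan_shift_funpow[THEN conjunct1]
  and holomorphic_tan_shift_funpow = tan_shift_funpow[THEN conjunct2]

lemma tan_shift_funpow_continuous_on: "continuous_on {z. regular lam n z} (tan_shift lam ^^ n)"
  by (rule holomorphic_on_imp_continuous_on[OF holomorphic_tan_shift_funpow])

lemma tan_shift_parts:
  assumes "cos z \<noteq> 0"
  shows "Re (tan_shift lam z) = Re lam + Re z + sin (2 * Re z) / (cos (2 * Re z) + cosh (2 * Im z))"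
    and "Im (tan_shift lam z) = Im lam + Im z + sinh (2 * Im z) / (cos (2 * Re z) + cosh (2 * Im z))"
  using tan_complex_parts[OF assms] by (simp_all add: tan_shift_def)

lemma open_hitting_set: "open S \<Longrightarrow> open {z. regular lam n z \<and> (tan_shift lam ^^ n) z \<in> S}"
  using continuous_open_preimage[OF tan_shift_funpow_continuous_on open_regular, of S lam n]
  by (simp add: Int_def vimage_def)

lemma open_basin: "open S \<Longrightarrow> open (basin lam S)"
proof -
  assume "open S"
  have "basin lam S = (\<Union>n. {z. regular lam n z \<and> (tan_shift lam ^^ n) z \<in> S})"
    by (auto simp: basin_def)
  then show ?thesis using open_hitting_set[OF \<open>open S\<close>] by auto
qed

lemma subset_basin: "S \<subseteq> basin lam S"
  unfolding basin_def by (auto intro: exI[of _ 0])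

lemma basin_backward: "cos z \<noteq> 0 \<Longrightarrow> tan_shift lam z \<in> basin lam S \<Longrightarrow> z \<in> basin lam S"
  unfolding basin_def
proof clarsimp
  fix n assume "cos z \<noteq> 0" "regular lam n (tan_shift lam z)" "(tan_shift lam ^^ n) (tan_shift lam z) \<in> S"
  then show "\<exists>n. regular lam n z \<and> (tan_shift lam ^^ n) z \<in> S"
    by (intro exI[of _ "Suc n"]) (simp add: regular_Suc_left funpow_swap1)
qed

text \<open>The chordal distance from w to infinity is exactly 2 / sqrt (1 + |w|^2).\<close>

lemma dist_stereo_infinity:
  assumes "w \<noteq> 0"
  shows "dist (stereo (Some w)) (stereo None) \<le> 2 / cmod w"
proof -
  define a where "a = (cmod w)\<^sup>2"
  have a: "a > 0" using assms by (simp add: a_def)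
  have "(a - 1) / (a + 1) - 1 = - 2 / (a + 1)" using a by (simp add: field_simps)
  then have "(dist (stereo (Some w)) (stereo None))\<^sup>2 = (2 / (1 + a) * cmod w)\<^sup>2 + (2 / (1 + a))\<^sup>2"
    using a by (simp add: dist_Pair_Pair dist_real_def a_def[symmetric] power_divide add.commute)
  also have "\<dots> = 4 / (1 + a)"
  proof -
    have "(2 / (1 + a) * cmod w)\<^sup>2 + (2 / (1 + a))\<^sup>2 = 4 * (1 + a) / (1 + a)\<^sup>2"
      by (simp add: power_mult_distrib a_def[symmetric] power_divide add_divide_distrib algebra_simps)
    also have "\<dots> = 4 / (1 + a)" using a by (simp add: power2_eq_square del: distrib_left_numeral)
    finally show ?thesis .
  qed
  also have "\<dots> \<le> (2 / cmod w)\<^sup>2"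
    using a by (simp add: power_divide a_def[symmetric] frac_le)
  finally show ?thesis by (rule power2_le_imp_le) simp
qed

lemma sphere_uniform_limit_infinity:
  assumes "\<And>R. \<forall>\<^sub>F n in sequentially. \<forall>z\<in>K. \<exists>w. F n z = Some w \<and> R < cmod w"
  shows "sphere_uniform_limit K F (\<lambda>_. None)"
  unfolding sphere_uniform_limit_def
proof (rule uniform_limitI)
  fix e :: real assume e: "e > 0"
  show "\<forall>\<^sub>F n in sequentially. \<forall>z\<in>K. dist (stereo (F n z)) (stereo None) < e"
  proof (rule eventually_mono[OF assms[of "2 / e"]], intro ballI)
    fix n z assume "\<forall>z\<in>K. \<exists>w. F n z = Some w \<and> 2 / e < cmod w" "z \<in> K"
    then obtain w where w: "F n z = Some w" "2 / e < cmod w" by blast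
    moreover have "cmod w > 0" using w(2) e by (meson divide_pos_pos less_trans zero_less_numeral)
    ultimately have "2 / cmod w < e" "w \<noteq> 0" using e by (auto simp: field_simps)
    then show "dist (stereo (F n z)) (stereo None) < e"
      using dist_stereo_infinity[of w] w(1) by simp
  qed
qed

text \<open>Given a sequence of iterates, either the orders tend to infinity, and then the whole
  sequence converges to infinity, or some order occurs infinitely often and gives a constant
  subsequence.\<close>

lemma normal_family_iterates_to_infinity:
  assumes "\<And>K. compact K \<Longrightarrow> K \<subseteq> V \<Longrightarrow> sphere_uniform_limit K (iter f) (\<lambda>_. None)"
  shows "normal_family_on V {iter f n |n. n > 0}"
  unfolding normal_family_on_def
proof (intro allI impI)
  fix F :: "nat \<Rightarrow> complex \<Rightarrow> complex option" assume F: "range F \<subseteq> {iter f n |n. n > 0}"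
  then have "\<forall>k. \<exists>n. F k = iter f n" by auto
  then obtain m where m: "\<And>k. F k = iter f (m k)" by metis
  show "\<exists>r g. strict_mono (r :: nat \<Rightarrow> nat) \<and>
      (\<forall>K. compact K \<and> K \<subseteq> V \<longrightarrow> sphere_uniform_limit K (\<lambda>n. F (r n)) g)"
  proof (cases "filterlim m at_top sequentially")
    case True
    have "sphere_uniform_limit K F (\<lambda>_. None)" if "compact K" "K \<subseteq> V" for K
      using assms[OF that] eventually_compose_filterlim[OF _ True]
      unfolding sphere_uniform_limit_def uniform_limit_iff m by fast
    then show ?thesis by (intro exI[of _ id] exI[of _ "\<lambda>_. None"]) (simp add: strict_mono_def)
  next
    case False
    then obtain c where "\<not> (\<forall>\<^sub>F k in sequentially. c \<le> m k)" by (auto simp: filterlim_at_top)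
    then have "infinite {k. m k \<le> c}"
      unfolding not_eventually frequently_cofinite[symmetric] cofinite_eq_sequentially
      by (rule frequently_elim1) simp
    moreover have "finite (m ` {k. m k \<le> c})" by (rule finite_subset[of _ "{..c}"]) auto
    ultimately obtain j where "infinite {a \<in> {k. m k \<le> c}. m a = m j}"
      using pigeonhole_infinite[of "{k. m k \<le> c}" m] by blast
    then have inf: "infinite {a. m a = m j}" by (rule contrapos_nn) (auto intro: finite_subset)
    define r where "r = enumerate {a. m a = m j}"
    have "m (r n) = m j" for n using enumerate_in_set[OF inf, of n] by (simp add: r_def)
    then have "sphere_uniform_limit K (\<lambda>n. F (r n)) (F j)" for K
      by (simp add: sphere_uniform_limit_def m uniform_limit_const)
    moreover have "strict_mono r" unfolding r_def by (rule strict_mono_enumerate[OF inf])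
    ultimately show ?thesis by blast
  qed
qed

text \<open>After subtracting the pole p nearest to h(z) in real part and dividing by pi, the
  function omits 0 and 1, the images of two neighbouring poles, and its value at the centre is
  bounded in terms of \<open>M\<close> alone. Schottky's theorem then gives a bound depending only
  on \<open>M\<close>, hence the same one for all iterates.\<close>

lemma omits_poles_Im_bound:
  fixes M :: real
  obtains C where
    "\<And>h z0 r z z'. \<lbrakk>0 < r; h holomorphic_on ball z0 r; \<And>u. u \<in> ball z0 r \<Longrightarrow> cos (h u) \<noteq> 0;
        z \<in> ball z0 (r / 4); z' \<in> ball z0 (r / 4); \<bar>Im (h z)\<bar> \<le> M\<rbrakk> \<Longrightarrow> \<bar>Im (h z')\<bar> \<le> C"
proof
  fix h and z0 :: complex and r z z'
  assume r: "0 < r" and h: "h holomorphic_on ball z0 r"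
    and nz: "\<And>u. u \<in> ball z0 r \<Longrightarrow> cos (h u) \<noteq> 0"
    and z: "z \<in> ball z0 (r / 4)" "z' \<in> ball z0 (r / 4)" and M: "\<bar>Im (h z)\<bar> \<le> M"
  obtain m :: int where m: "\<bar>Re (h z) - pi / 2 - of_int m * pi\<bar> \<le> pi / 2"
    by (rule nearest_of_int_pi)
  define p where "p = (of_real (pi / 2 + of_int m * pi) :: complex)"
  \<comment> \<open>The radius 5r/8 fits: the disc about z stays within 7r/8 of \<open>z0\<close>,
    and z' has distance at most r/2 from z, which is 4/5 of the radius.\<close>
  define g where "g = (\<lambda>u. (h (z + of_real (5 * r / 8) * u) - p) / of_real pi)"
  have sub: "z + of_real (5 * r / 8) * u \<in> ball z0 r" if "u \<in> cball 0 1" for u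
  proof -
    have "cmod (of_real (5 * r / 8) * u) \<le> 5 * r / 8"
      using that r by (simp add: norm_mult mult_left_le)
    moreover have "cmod (z - z0) < r / 4" using z by (simp add: dist_norm norm_minus_commute)
    ultimately have "cmod (z - z0 + of_real (5 * r / 8) * u) < r"
      using norm_triangle_ineq[of "z - z0" "of_real (5 * r / 8) * u"] r by linarith
    then show ?thesis by (simp add: dist_norm norm_minus_commute algebra_simps)
  qed
  have "(h \<circ> (\<lambda>u. z + of_real (5 * r / 8) * u)) holomorphic_on cball 0 1"
    using sub by (intro holomorphic_on_compose_gen[OF _ h] holomorphic_intros) auto
  then have hol: "g holomorphic_on cball 0 1"
    unfolding g_def o_def by (intro holomorphic_intros) auto
  have omit: "\<not> (g u = 0 \<or> g u = 1)" if u: "u \<in> cball 0 1" for u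
  proof
    assume "g u = 0 \<or> g u = 1"
    then have "h (z + of_real (5 * r / 8) * u) = p \<or> h (z + of_real (5 * r / 8) * u) = p + of_real pi"
      by (auto simp: g_def field_simps)
    moreover have "cos p = 0" "cos (p + of_real pi) = 0"
      using cos_half_pi_plus_of_int_pi[of m] cos_half_pi_plus_of_int_pi[of "m + 1"]
      by (simp_all add: p_def algebra_simps)
    ultimately show False using nz[OF sub[OF u]] by auto
  qed
  have "cmod (h z - p) \<le> \<bar>Re (h z - p)\<bar> + \<bar>Im (h z - p)\<bar>" by (rule cmod_le)
  also have "\<dots> \<le> pi / 2 + M" using m M by (simp add: p_def algebra_simps)
  also have "\<dots> \<le> pi * (1 + M)"
  proof -
    have "1 * M \<le> pi * M" using M pi_ge_two by (intro mult_right_mono) linarith+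
    then show ?thesis using pi_gt_zero unfolding distrib_left mult_1_right by linarith
  qed
  finally have g0: "cmod (g 0) \<le> 1 + M" by (simp add: g_def norm_divide field_simps)
  define u where "u = (z' - z) / of_real (5 * r / 8)"
  have "cmod (z' - z) \<le> r / 2"
    using dist_triangle[of z' z z0] z by (simp add: dist_norm norm_minus_commute)
  then have u: "cmod u \<le> 4 / 5" using r unfolding u_def norm_divide by (simp add: divide_simps)
  have z': "z' = z + of_real (5 * r / 8) * u"
  proof -
    have "complex_of_real (5 * r / 8) \<noteq> 0" using r by simp
    then show ?thesis unfolding u_def by (simp only: nonzero_mult_div_cancel_left times_divide_eq_right) simp
  qed
  define B where "B = exp (pi * exp (pi * (2 + 2 * (1 + M) + 12 * (4 / 5) / (1 - 4 / 5 :: real))))"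
  have "cmod (g u) \<le> B"
    unfolding B_def by (rule Schottky[OF hol g0 omit _ _ u]) auto
  then have "cmod (h z' - p) \<le> pi * B" by (simp add: g_def z' norm_divide field_simps)
  moreover have "Im (h z') = Im (h z' - p)" by (simp add: p_def)
  ultimately show "\<bar>Im (h z')\<bar>
      \<le> pi * exp (pi * exp (pi * (2 + 2 * (1 + M) + 12 * (4 / 5) / (1 - 4 / 5 :: real))))"
    using abs_Im_le_cmod[of "h z' - p"] by (simp only: B_def)
qed

text \<open>The sign \<open>\<sigma>\<close> lets one development serve an upper and a lower
  half-plane. The uniform drift \<open>\<delta>\<close> makes imaginary parts grow linearly along
  orbits.\<close>

locale escaping_half_plane =
  fixes lam :: complex and \<sigma> M \<delta> :: real
  assumes sign: "\<sigma> = 1 \<or> \<sigma> = - 1" and M_nonneg: "0 \<le> M" and delta_pos: "0 < \<delta>"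
    and step: "\<And>z. M < \<sigma> * Im z \<Longrightarrow> \<sigma> * Im z + \<delta> \<le> \<sigma> * Im (tan_shift lam z)"
begin

abbreviation half_plane :: "complex set" where
  "half_plane \<equiv> {z. M < \<sigma> * Im z}"

abbreviation attracted :: "complex set" where
  "attracted \<equiv> basin lam half_plane"

lemma abs_Im: "\<bar>Im z\<bar> = \<bar>\<sigma> * Im z\<bar>"
  using sign by auto

lemma half_plane_cos_nonzero: "z \<in> half_plane \<Longrightarrow> cos z \<noteq> 0"
  using M_nonneg by (intro cos_complex_nonzero) auto

lemma half_plane_funpow:
  assumes "z \<in> half_plane"
  shows "regular lam n z \<and> \<sigma> * Im z + n * \<delta> \<le> \<sigma> * Im ((tan_shift lam ^^ n) z)"
proof (induction n)
  case (Suc n)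
  have "0 \<le> n * \<delta>" using delta_pos by simp
  then have "M < \<sigma> * Im ((tan_shift lam ^^ n) z)" using Suc assms by auto
  with Suc step[OF this] half_plane_cos_nonzero[of "(tan_shift lam ^^ n) z"] show ?case
    by (auto simp: regular_Suc algebra_simps)
qed simp

lemma half_plane_funpow_mem: "z \<in> half_plane \<Longrightarrow> (tan_shift lam ^^ n) z \<in> half_plane"
proof -
  assume "z \<in> half_plane"
  moreover have "0 \<le> n * \<delta>" using delta_pos by simp
  ultimately show ?thesis using half_plane_funpow[of z n] by auto
qed

lemma open_half_plane: "open half_plane"
  by (intro open_Collect_less continuous_intros)

lemma connected_half_plane: "connected half_plane"
proof -
  have "half_plane = {z. inner (Complex 0 \<sigma>) z > M}" by (simp add: inner_complex_def)
  then show ?thesis by (simp add: convex_halfspace_gt convex_connected)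
qed

lemma half_plane_nonempty: "half_plane \<noteq> {}"
proof -
  have "\<sigma> * Im (Complex 0 (\<sigma> * (M + 1))) = M + 1" using sign by auto
  then show ?thesis by (metis (mono_tags, lifting) empty_iff less_add_one mem_Collect_eq)
qed

lemma open_attracted: "open attracted"
  by (rule open_basin[OF open_half_plane])

lemma hits_at:
  assumes "regular lam N z" "(tan_shift lam ^^ N) z \<in> half_plane"
  shows "regular lam (N + n) z \<and>
    M + n * \<delta> \<le> \<sigma> * Im ((tan_shift lam ^^ (N + n)) z)"
proof -
  have "(tan_shift lam ^^ (N + n)) z = (tan_shift lam ^^ n) ((tan_shift lam ^^ N) z)"
    by (rule funpow_add_apply)
  then show ?thesis using assms half_plane_funpow[OF assms(2), of n] regular_add[OF assms(1), of n] by auto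
qed

lemma attracted_regular: "z \<in> attracted \<Longrightarrow> regular lam n z"
  unfolding basin_def using hits_at[of _ z n] regular_mono[of n "_ + n" lam z]
  by (auto simp del: mem_Collect_eq)

lemma attracted_forward: "z \<in> attracted \<Longrightarrow> tan_shift lam z \<in> attracted"
proof -
  assume z: "z \<in> attracted"
  then obtain n where n: "regular lam n z" "(tan_shift lam ^^ n) z \<in> half_plane"
    by (auto simp: basin_def)
  have "regular lam (Suc n) z" using z by (rule attracted_regular)
  then have "regular lam n (tan_shift lam z)" by (simp add: regular_Suc_left)
  moreover have "(tan_shift lam ^^ n) (tan_shift lam z) \<in> half_plane"
    using half_plane_funpow_mem[OF n(2), of 1] by (simp add: funpow_swap1)
  ultimately show ?thesis by (auto simp: basin_def)
qed

text \<open>The sets \<open>W n\<close> of points that are in the half-plane at time n are open and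
  increase with n, so a compact set lies in one of them; from that time on the drift is
  uniform.\<close>

lemma attracted_uniformly:
  assumes "compact K" "K \<subseteq> attracted"
  shows "sphere_uniform_limit K (iter (tan_map lam)) (\<lambda>_. None)"
proof -
  define W where "W = (\<lambda>n. {z. regular lam n z \<and> (tan_shift lam ^^ n) z \<in> half_plane})"
  have "W n \<subseteq> W (n + k)" for n k
    using half_plane_funpow half_plane_funpow_mem[of _ k]
    unfolding W_def funpow_add_apply by (blast intro: regular_add)
  then have mono: "m \<le> n \<Longrightarrow> W m \<subseteq> W n" for m n using le_Suc_ex by blast
  have "\<forall>n\<in>UNIV. open (W n)" unfolding W_def using open_hitting_set[OF open_half_plane] by blast
  moreover have "K \<subseteq> (\<Union>n\<in>UNIV. W n)" using assms(2) by (auto simp: W_def basin_def)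
  ultimately obtain C where C: "finite C" "K \<subseteq> (\<Union>n\<in>C. W n)"
    using compactE_image[OF assms(1), of UNIV W] by metis
  obtain N where "\<forall>n\<in>C. n \<le> N" using C(1) finite_nat_set_iff_bounded_le by auto
  then have N: "K \<subseteq> W N" using C(2) mono by blast
  show ?thesis
  proof (rule sphere_uniform_limit_infinity)
    fix R :: real
    obtain k :: nat where k: "R < k * \<delta>" using reals_Archimedean3[OF delta_pos] by blast
    show "\<forall>\<^sub>F n in sequentially. \<forall>z\<in>K. \<exists>w. iter (tan_map lam) n z = Some w \<and> R < cmod w"
      unfolding eventually_sequentially
    proof (intro exI[of _ "N + k"] allI impI ballI)
      fix n z assume n: "N + k \<le> n" and z: "z \<in> K"
      define j where "j = n - N"
      have j: "n = N + j" "k \<le> j" using n by (auto simp: j_def)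
      have h: "regular lam n z" "M + j * \<delta> \<le> \<sigma> * Im ((tan_shift lam ^^ n) z)"
        using hits_at[of N z j] N z unfolding j W_def by auto
      have "k * \<delta> \<le> j * \<delta>" using j delta_pos by simp
      then have "R < \<bar>Im ((tan_shift lam ^^ n) z)\<bar>" using h k M_nonneg unfolding abs_Im by linarith
      then have "R < cmod ((tan_shift lam ^^ n) z)" using abs_Im_le_cmod less_le_trans by blast
      then show "\<exists>w. iter (tan_map lam) n z = Some w \<and> R < cmod w"
        using h by (simp add: iter_tan_map)
    qed
  qed
qed

lemma attracted_subset_fatou: "attracted \<subseteq> fatou_set (tan_map lam)"
proof
  fix z assume "z \<in> attracted"
  moreover have "all_iterates_defined_on (tan_map lam) attracted"
    using attracted_regular by (auto simp: all_iterates_defined_on_def iter_tan_map)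
  moreover have "normal_family_on attracted {iter (tan_map lam) n |n. n > 0}"
    by (rule normal_family_iterates_to_infinity[OF attracted_uniformly])
  ultimately show "z \<in> fatou_set (tan_map lam)"
    unfolding fatou_set_def using open_attracted by blast
qed

text \<open>
  Since the iterates omit the equally spaced poles, Schottky's theorem bounds them near any point
  where their imaginary part is moderate.
\<close>

lemma attracted_absorbs:
  assumes V: "open V" "connected V" and reg: "\<And>z n. z \<in> V \<Longrightarrow> regular lam n z"
    and meet: "V \<inter> attracted \<noteq> {}"
  shows "V \<subseteq> attracted"
proof -
  have "open (V - attracted)"
    unfolding open_contains_ball
  proof
    fix z0 assume z0: "z0 \<in> V - attracted"
    then obtain r where r: "r > 0" "ball z0 r \<subseteq> V" using V(1) openE[of V z0] by blast
    have below: "\<sigma> * Im ((tan_shift lam ^^ n) z0) \<le> M" for n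
      using z0 reg[of z0 n] by (auto simp: basin_def not_less)
    obtain C where C: "\<And>h z0 r z z'. \<lbrakk>0 < r; h holomorphic_on ball z0 r;
        \<And>u. u \<in> ball z0 r \<Longrightarrow> cos (h u) \<noteq> 0; z \<in> ball z0 (r / 4); z' \<in> ball z0 (r / 4);
        \<bar>Im (h z)\<bar> \<le> M\<rbrakk> \<Longrightarrow> \<bar>Im (h z')\<bar> \<le> C"
      using omits_poles_Im_bound[of M] by blast
    have "ball z0 (r / 4) \<inter> attracted = {}"
    proof (rule ccontr)
      assume "ball z0 (r / 4) \<inter> attracted \<noteq> {}"
      then obtain z1 N where z1: "z1 \<in> ball z0 (r / 4)" "regular lam N z1" "(tan_shift lam ^^ N) z1 \<in> half_plane"
        by (auto simp: basin_def)
      obtain k :: nat where k: "C < k * \<delta>" using reals_Archimedean3[OF delta_pos] by blast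
      define h where "h = tan_shift lam ^^ (N + k)"
      have above: "M + k * \<delta> \<le> \<sigma> * Im (h z1)" using hits_at[OF z1(2,3), of k] by (simp add: h_def)
      have sub: "closed_segment z0 z1 \<subseteq> ball z0 (r / 4)"
        using z1(1) r(1) by (intro closed_segment_subset) auto
      have holV: "h holomorphic_on ball z0 r"
        unfolding h_def using reg r(2)
        by (intro holomorphic_on_subset[OF holomorphic_tan_shift_funpow]) auto
      \<comment> \<open>By the intermediate value theorem the iterate \<open>h\<close> is at height
        exactly \<open>M\<close> somewhere between \<open>z0\<close> and \<open>z1\<close>. That
        point serves as the base point of the Schottky bound, which the height of
        \<open>h z1\<close> exceeds by the choice of \<open>k\<close>.\<close>
      have "continuous_on (closed_segment z0 z1) (\<lambda>u. \<sigma> * Im (h u))"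
        using holomorphic_on_imp_continuous_on[OF holV] sub r(1)
        by (intro continuous_intros) (auto elim!: continuous_on_subset)
      then have "connected ((\<lambda>u. \<sigma> * Im (h u)) ` closed_segment z0 z1)"
        by (rule connected_continuous_image) simp
      moreover have "\<sigma> * Im (h z0) \<le> M" unfolding h_def by (rule below)
      moreover have "M \<le> \<sigma> * Im (h z1)" 
        using above delta_pos mult_nonneg_nonneg[of k \<delta>] by linarith
      ultimately have "M \<in> (\<lambda>u. \<sigma> * Im (h u)) ` closed_segment z0 z1"
        unfolding connected_iff_interval by blast
      then obtain u where u: "u \<in> closed_segment z0 z1" "\<sigma> * Im (h u) = M" by auto
      \<comment> \<open>Regularity is used one order beyond that of \<open>h\<close>, because it
        must exclude that the value of \<open>h\<close> itself is a pole.\<close>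
      have "cos (h v) \<noteq> 0" if "v \<in> ball z0 r" for v
        using reg[of v "Suc (N + k)"] that r(2) by (auto simp: regular_Suc h_def)
      then have "\<bar>Im (h z1)\<bar> \<le> C"
        using C[OF r(1) holV _ _ z1(1), of u] u sub M_nonneg by (auto simp: abs_Im[of "h u"])
      moreover have "C < \<bar>Im (h z1)\<bar>" using above k M_nonneg unfolding abs_Im by linarith
      ultimately show False by simp
    qed
    moreover have "ball z0 (r / 4) \<subseteq> ball z0 r" using r(1) by (intro subset_ball) simp
    ultimately show "\<exists>e>0. ball z0 e \<subseteq> V - attracted"
      using r by (intro exI[of _ "r / 4"]) auto
  qed
  moreover have "open (V \<inter> attracted)" using V open_attracted by blast
  ultimately have "V - attracted = {}"
    using connectedD[OF V(2), of "V \<inter> attracted" "V - attracted"] meet by blast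
  then show ?thesis by blast
qed

end

subsection \<open>Connectedness of basins\<close>

lemma sin_cos_at_pole:
  fixes p v :: complex
  assumes "cos p = 0"
  shows "sin (p + v) = sin p * cos v" and "cos (p + v) = - sin p * sin v" and "sin p \<noteq> 0"
  using assms sin_cos_squared_add[of p] by (auto simp: sin_add cos_add)

lemma tan_at_pole:
  fixes p v :: complex
  assumes "cos p = 0"
  shows "tan (p + v) = - cos v / sin v"
  using sin_cos_at_pole[OF assms] by (simp add: tan_def)

text \<open>At a pole p one has f(p + v) - lam - p = v - cot v, an expression free of p and lam. Its
  reciprocal is \<open>\<kappa>\<close>, which is holomorphic at 0 with derivative -1 and so has a
  local inverse \<open>\<theta>\<close>. The radii \<open>\<epsilon>\<close> and
  \<open>\<rho>\<close> are therefore the same for all poles.\<close>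

lemma local_inverse_near_poles:
  obtains \<epsilon> \<rho> :: real and \<theta> :: "complex \<Rightarrow> complex" where
    "0 < \<epsilon>" "0 < \<rho>" "continuous_on (ball 0 \<epsilon>) \<theta>"
    "\<And>lam p w. \<lbrakk>cos p = 0; 1 / \<epsilon> < cmod (w - lam - p)\<rbrakk> \<Longrightarrow>
       cos (p + \<theta> (1 / (w - lam - p))) \<noteq> 0 \<and> tan_shift lam (p + \<theta> (1 / (w - lam - p))) = w"
    "\<And>lam p v. \<lbrakk>cos p = 0; cmod v < \<rho>; cos (p + v) \<noteq> 0;
       1 / \<epsilon> < cmod (tan_shift lam (p + v) - lam - p)\<rbrakk> \<Longrightarrow>
       \<theta> (1 / (tan_shift lam (p + v) - lam - p)) = v"
proof -
  define d where "d = (\<lambda>v::complex. v * sin v - cos v)"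
  define \<kappa> where "\<kappa> = (\<lambda>v. sin v / d v)"
  define S where "S = {v. d v \<noteq> 0}"
  have "closed {v. d v = 0}"
    unfolding d_def by (intro closed_Collect_eq continuous_intros)
  then have S: "open S" by (simp add: S_def closed_def Compl_eq)
  have S0: "0 \<in> S" by (simp add: S_def d_def)
  have hol: "\<kappa> holomorphic_on S"
    unfolding \<kappa>_def d_def S_def by (intro holomorphic_intros) auto
  have "(\<kappa> has_field_derivative - 1) (at 0)"
    unfolding \<kappa>_def d_def by (rule derivative_eq_intros refl | simp)+
  then have "deriv \<kappa> 0 \<noteq> 0" using DERIV_imp_deriv[of \<kappa> "- 1" 0] by simp
  then obtain r where r: "r > 0" "ball 0 r \<subseteq> S" "open (\<kappa> ` ball 0 r)" "inj_on \<kappa> (ball 0 r)"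
    using has_complex_derivative_locally_invertible[OF hol S0 S] by blast
  have hol_r: "\<kappa> holomorphic_on ball 0 r" using hol r(2) holomorphic_on_subset by blast
  obtain \<theta> where \<theta>: "\<theta> holomorphic_on \<kappa> ` ball 0 r" "\<And>z. z \<in> ball 0 r \<Longrightarrow> \<theta> (\<kappa> z) = z"
    by (rule holomorphic_has_inverse[OF hol_r open_ball r(4)], rule that)
  have \<kappa>0: "\<kappa> 0 = 0" by (simp add: \<kappa>_def)
  then have "0 \<in> \<kappa> ` ball 0 r" using r(1) by (metis centre_in_ball image_eqI)
  then obtain \<epsilon> where \<epsilon>: "\<epsilon> > 0" "ball 0 \<epsilon> \<subseteq> \<kappa> ` ball 0 r" using r(3) openE by blast
  have \<kappa>: "sin v \<noteq> 0 \<and> v - cos v / sin v = 1 / \<kappa> v" if "v \<in> ball 0 r" "v \<noteq> 0" for v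
  proof -
    have "\<kappa> v \<noteq> \<kappa> 0" using that r(1,4) inj_on_eq_iff[OF r(4), of v 0] by simp
    then have "sin v \<noteq> 0" using \<kappa>0 by (auto simp: \<kappa>_def)
    moreover have "d v \<noteq> 0" using that(1) r(2) by (auto simp: S_def)
    ultimately show ?thesis by (simp add: \<kappa>_def d_def field_simps)
  qed
  have F: "tan_shift lam (p + v) = lam + p + 1 / \<kappa> v \<and> cos (p + v) \<noteq> 0"
    if "cos p = 0" "v \<in> ball 0 r" "v \<noteq> 0" for lam p v
    using \<kappa>[OF that(2,3)] tan_at_pole[OF that(1), of v] sin_cos_at_pole(1,2)[OF that(1), of v] sin_cos_at_pole(3)[OF that(1)]
    by (simp add: tan_shift_def)
  show thesis
  proof (rule that[OF \<epsilon>(1) r(1), of \<theta>])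
    show "continuous_on (ball 0 \<epsilon>) \<theta>"
      using \<theta>(1) \<epsilon>(2) holomorphic_on_imp_continuous_on continuous_on_subset by blast
  next
    fix lam p w :: complex assume p: "cos p = 0" and w: "1 / \<epsilon> < cmod (w - lam - p)"
    define u where "u = 1 / (w - lam - p)"
    have "0 < cmod (w - lam - p)" using w \<epsilon>(1) by (meson divide_pos_pos less_trans zero_less_one)
    then have u: "u \<in> ball 0 \<epsilon>" "u \<noteq> 0" using w \<epsilon>(1) by (auto simp: u_def norm_divide field_simps)
    then obtain v where v: "v \<in> ball 0 r" "u = \<kappa> v" using \<epsilon>(2) by blast
    moreover have "v \<noteq> 0" using v u(2) \<kappa>0 by auto
    ultimately have "tan_shift lam (p + \<theta> u) = lam + p + 1 / u \<and> cos (p + \<theta> u) \<noteq> 0"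
      using F[OF p, of v lam] \<theta>(2) by simp
    then show "cos (p + \<theta> (1 / (w - lam - p))) \<noteq> 0 \<and> tan_shift lam (p + \<theta> (1 / (w - lam - p))) = w"
      unfolding u_def by simp
  next
    fix lam p v :: complex assume "cos p = 0" "cmod v < r" "cos (p + v) \<noteq> 0"
    moreover from this have "v \<noteq> 0" by auto
    ultimately show "\<theta> (1 / (tan_shift lam (p + v) - lam - p)) = v"
      using F[of p v lam] \<theta>(2)[of v] by simp
  qed
qed

text \<open>Writing u = p + v with the pole p nearest in real part, |tan u| = |cot v| <= 1 + 1 /
  |sin v|, so a large value makes sin v small. This excludes |Re v| = pi / 2, where |sin v| >= 1;
  hence v = Arcsin (sin v), which is small by continuity of \<open>Arcsin\<close> at 0.\<close>

lemma tan_large_near_pole: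
  fixes \<rho> :: real
  assumes "\<rho> > 0"
  obtains R where "\<And>u::complex. \<lbrakk>cos u \<noteq> 0; R < cmod (tan u)\<rbrakk> \<Longrightarrow> \<exists>p. cos p = 0 \<and> cmod (u - p) < \<rho>"
proof -
  have "isCont Arcsin (0 :: complex)" by (rule isCont_Arcsin) simp
  then obtain \<eta> where \<eta>: "\<eta> > 0" "\<And>w. cmod w < \<eta> \<Longrightarrow> cmod (Arcsin w) < \<rho>"
    using assms unfolding continuous_at_eps_delta by (auto simp: dist_norm)
  define e where "e = min \<eta> 1"
  have e: "e > 0" using \<eta> by (simp add: e_def)
  show thesis
  proof (rule that[of "1 + 1 / e"])
    fix u :: complex assume u: "cos u \<noteq> 0" "1 + 1 / e < cmod (tan u)"
    obtain m :: int where m: "\<bar>Re u - pi / 2 - of_int m * pi\<bar> \<le> pi / 2"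
      by (rule nearest_of_int_pi)
    define p where "p = complex_of_real (pi / 2 + of_int m * pi)"
    define v where "v = u - p"
    have p: "cos p = 0" unfolding p_def by (rule cos_half_pi_plus_of_int_pi)
    have v: "\<bar>Re v\<bar> \<le> pi / 2" using m by (simp add: v_def p_def algebra_simps)
    have sv: "sin v \<noteq> 0" using u(1) sin_cos_at_pole(2)[OF p, of v] by (auto simp: v_def)
    have tan_u: "cmod (tan u) = cmod (cos v) / cmod (sin v)"
      using tan_at_pole[OF p, of v] by (simp add: v_def norm_divide)
    have "cmod (cos v) \<le> 1 + cmod (sin v)"
    proof (rule power2_le_imp_le)
      have "(cmod (cos v))\<^sup>2 = cmod (1 - (sin v)\<^sup>2)" by (simp add: cos_squared_eq flip: norm_power)
      also have "\<dots> \<le> 1 + (cmod (sin v))\<^sup>2" using norm_triangle_ineq4[of 1 "(sin v)\<^sup>2"] by (simp add: norm_power)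
      also have "\<dots> \<le> (1 + cmod (sin v))\<^sup>2" by (simp add: power2_sum)
      finally show "(cmod (cos v))\<^sup>2 \<le> (1 + cmod (sin v))\<^sup>2" .
    qed simp
    then have "cmod (tan u) \<le> (1 + cmod (sin v)) / cmod (sin v)"
      unfolding tan_u by (rule divide_right_mono) simp
    also have "\<dots> = 1 + 1 / cmod (sin v)" using sv by (simp add: field_simps)
    finally have "1 / e < 1 / cmod (sin v)" using u(2) by linarith
    then have small: "cmod (sin v) < e" using e sv by (simp add: field_simps)
    have "\<bar>Re v\<bar> \<noteq> pi / 2"
    proof
      assume "\<bar>Re v\<bar> = pi / 2"
      then have "Re v = pi / 2 \<or> Re v = - (pi / 2)" by linarith
      then have "\<bar>sin (Re v)\<bar> = 1" by (elim disjE) (simp_all del: eq_divide_eq_numeral1)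
      then have "1 \<le> \<bar>Re (sin v)\<bar>" by (simp add: Re_sin_cosh abs_mult cosh_real_ge_1)
      then show False using small abs_Re_le_cmod[of "sin v"] by (simp add: e_def)
    qed
    then have "Arcsin (sin v) = v" using v by (intro Arcsin_sin) auto
    then have "cmod v < \<rho>" using \<eta>(2)[of "sin v"] small by (simp add: e_def)
    then show "\<exists>p. cos p = 0 \<and> cmod (u - p) < \<rho>" using p by (auto simp: v_def)
  qed
qed

text \<open>The open mapping theorem asks for this on every open subset. If f' vanished on an open
  set, (cos z)^2 would be constantly -1 there; differentiating gives sin z = 0, hence (cos z)^2 =
  1.\<close>

lemma tan_shift_not_constant:
  assumes "open U" "U \<subseteq> {z. cos z \<noteq> 0}" "U \<noteq> {}"
  shows "\<not> tan_shift lam constant_on U"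
proof
  assume "tan_shift lam constant_on U"
  then obtain c where c: "\<And>z. z \<in> U \<Longrightarrow> tan_shift lam z = c" by (auto simp: constant_on_def)
  have sq: "(cos z)\<^sup>2 = - 1" if "z \<in> U" for z
  proof -
    have "((\<lambda>_. c) has_field_derivative (1 + 1 / (cos z)\<^sup>2)) (at z)"
      using that assms(2) c
      by (intro has_field_derivative_transform_within_open[OF tan_shift_has_field_derivative assms(1)]) auto
    then have "1 + 1 / (cos z)\<^sup>2 = 0" using DERIV_unique DERIV_const by blast
    then show ?thesis 
      using that assms(2) by (auto simp: field_simps eq_neg_iff_add_eq_0 dest!: subsetD)
  qed
  obtain z where z: "z \<in> U" using assms(3) by blast
  have "((\<lambda>_. - 1) has_field_derivative (- 2 * cos z * sin z)) (at z)"
    by (rule has_field_derivative_transform_within_open[OF _ assms(1) z, of "\<lambda>z. (cos z)\<^sup>2"])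
      (auto intro!: derivative_eq_intros simp: sq)
  then have "- 2 * cos z * sin z = 0" using DERIV_unique DERIV_const by blast
  then have "sin z = 0" using z assms(2) by auto
  then have "(cos z)\<^sup>2 = 1" using sin_cos_squared_add[of z] by simp
  then show False using sq[OF z] by simp
qed

lemma open_tan_shift_image:
  assumes "open U" "U \<subseteq> {z. cos z \<noteq> 0}"
  shows "open (tan_shift lam ` U)"
proof (rule open_mapping_thm2[OF tan_shift_holomorphic open_cos_nonzero assms])
  show "\<not> tan_shift lam constant_on X" if "open X" "X \<subseteq> {z. cos z \<noteq> 0}" "X \<noteq> {}" for X
    using that by (rule tan_shift_not_constant)
qed

text \<open>The relation (f(u) - lam - u) * cos u = sin u has no denominator and passes to the
  limit. At a pole it would make sin l and cos l vanish together.\<close>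

lemma tan_shift_limit_point:
  assumes lim: "u \<longlonglongrightarrow> l" and nz: "\<And>n. cos (u n) \<noteq> 0" and img: "(\<lambda>n. tan_shift lam (u n)) \<longlonglongrightarrow> b"
  shows "cos l \<noteq> 0" and "tan_shift lam l = b"
proof -
  have "(\<lambda>n. (tan_shift lam (u n) - lam - u n) * cos (u n)) \<longlonglongrightarrow> (b - lam - l) * cos l"
    by (intro tendsto_intros lim img)
  moreover have "(tan_shift lam (u n) - lam - u n) * cos (u n) = sin (u n)" for n
    using nz[of n] by (simp add: tan_shift_def tan_def)
  moreover have "(\<lambda>n. sin (u n)) \<longlonglongrightarrow> sin l" by (intro tendsto_intros lim)
  ultimately have "sin l = (b - lam - l) * cos l" using LIMSEQ_unique by fastforce
  then show l: "cos l \<noteq> 0" using sin_cos_squared_add[of l] by auto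
  have "isCont (tan_shift lam) l" using tan_shift_has_field_derivative[OF l] by (rule DERIV_isCont)
  then have "(\<lambda>n. tan_shift lam (u n)) \<longlonglongrightarrow> tan_shift lam l" using lim isCont_tendsto_compose by blast
  then show "tan_shift lam l = b" using img LIMSEQ_unique by blast
qed

lemma open_tan_shift_preimage: "open G \<Longrightarrow> open {z. cos z \<noteq> 0 \<and> tan_shift lam z \<in> G}"
  using continuous_open_preimage[OF holomorphic_on_imp_continuous_on[OF tan_shift_holomorphic] open_cos_nonzero, of G]
  by (simp add: Int_def vimage_def)

text \<open>
  The part of the preimage of \<open>G\<close> lying outside \<open>G\<close> is mapped onto a relatively clopen subset of
  \<open>G\<close>: points of it tending to infinity have bounded images only near far-away poles, where a path in
  \<open>G\<close> can be lifted by the local inverse.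
\<close>

lemma (in escaping_half_plane) attracted_connected:
  assumes G: "G \<in> components attracted" "half_plane \<subseteq> G"
    and pre: "\<And>z. cos z \<noteq> 0 \<Longrightarrow> tan_shift lam z \<in> half_plane \<Longrightarrow> z \<in> G"
  shows "connected attracted"
proof -
  have openG: "open G" and connG: "connected G" and subG: "G \<subseteq> attracted"
    using G(1) open_attracted open_components in_components_connected in_components_subset by blast+
  have absorb: "T \<subseteq> G" if "connected T" "T \<subseteq> attracted" "T \<inter> G \<noteq> {}" for T
    using components_maximal[OF G(1) that(1,2)] that(3) by blast
  have lift: "cos z \<noteq> 0 \<Longrightarrow> tan_shift lam z \<in> G \<Longrightarrow> z \<in> attracted" for z
    using basin_backward subG by blast
  define P where "P = {z. cos z \<noteq> 0 \<and> tan_shift lam z \<in> G}"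
  have openP: "open P" unfolding P_def by (rule open_tan_shift_preimage[OF openG])
  have PA: "P \<subseteq> attracted" using lift by (auto simp: P_def)
  have "open (attracted - G)"
  proof -
    have "attracted - G = \<Union>(components attracted - {G})"
      using components_nonoverlap[OF G(1)] Union_components[of attracted] G(1) by blast
    then show ?thesis using open_attracted open_components by (metis DiffD1 open_Union)
  qed
  have openO: "open (P - G)"
  proof -
    have "P - G = P \<inter> (attracted - G)" using PA by blast
    then show ?thesis using openP \<open>open (attracted - G)\<close> by (metis open_Int)
  qed
  define I where "I = tan_shift lam ` (P - G)"
  have "open I" unfolding I_def using openO by (intro open_tan_shift_image) (auto simp: P_def)
  have "I \<subseteq> G" by (auto simp: I_def P_def)
  have "I \<inter> half_plane = {}" using pre by (auto simp: I_def P_def)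
  have "open (G - I)"
    unfolding open_contains_ball
  proof (rule ballI, rule ccontr)
    fix b assume b: "b \<in> G - I" and no: "\<not> (\<exists>e>0. ball b e \<subseteq> G - I)"
    obtain r where r: "r > 0" "cball b r \<subseteq> G" using b openG open_contains_cball by blast
    obtain s where s: "s \<in> half_plane" using half_plane_nonempty by blast
    have "path_connected G" using openG connG connected_open_path_connected by blast
    then obtain \<gamma> where \<gamma>: "path \<gamma>" "path_image \<gamma> \<subseteq> G" "pathstart \<gamma> = b" "pathfinish \<gamma> = s"
      using b s G(2) unfolding path_connected_def by (metis Diff_iff subsetD)
    \<comment> \<open>\<open>T\<close> is a compact connected subset of \<open>G\<close> joining all
      values near \<open>b\<close> to a point \<open>s\<close> of the half-plane. A lift of
      \<open>T\<close> contains a preimage of \<open>s\<close>, which lies in \<open>G\<close> by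
      \<open>pre\<close>, so the entire lift lies in \<open>G\<close>.\<close>
    define T where "T = cball b r \<union> path_image \<gamma>"
    have bs: "b \<in> path_image \<gamma>" "s \<in> T" using \<gamma> pathstart_in_path_image pathfinish_in_path_image by (auto simp: T_def)
    have T: "compact T" "T \<subseteq> G" "ball b r \<subseteq> T"
      using r \<gamma> compact_path_image by (auto simp: T_def)
    have connT: "connected T"
      unfolding T_def
    proof (rule connected_Un)
      show "cball b r \<inter> path_image \<gamma> \<noteq> {}" using bs(1) r(1) centre_in_cball[of b r] by force
    qed (use \<gamma>(1) connected_path_image in auto)
    obtain R where R: "\<And>w. w \<in> T \<Longrightarrow> cmod w \<le> R" using compact_imp_bounded[OF T(1)] bounded_iff by blast
    obtain \<epsilon> \<rho> \<theta> where inverse: "0 < \<epsilon>" "0 < \<rho>" "continuous_on (ball 0 \<epsilon>) \<theta>"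
      and right: "\<And>lam p w. \<lbrakk>cos p = 0; 1 / \<epsilon> < cmod (w - lam - p)\<rbrakk> \<Longrightarrow>
       cos (p + \<theta> (1 / (w - lam - p))) \<noteq> 0 \<and> tan_shift lam (p + \<theta> (1 / (w - lam - p))) = w"
      and left: "\<And>lam p v. \<lbrakk>cos p = 0; cmod v < \<rho>; cos (p + v) \<noteq> 0;
       1 / \<epsilon> < cmod (tan_shift lam (p + v) - lam - p)\<rbrakk> \<Longrightarrow>
       \<theta> (1 / (tan_shift lam (p + v) - lam - p)) = v"
      by (rule local_inverse_near_poles, rule that)
    obtain R1 where R1: "\<And>u::complex. \<lbrakk>cos u \<noteq> 0; R1 < cmod (tan u)\<rbrakk> \<Longrightarrow> \<exists>p. cos p = 0 \<and> cmod (u - p) < \<rho>"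
      by (rule tan_large_near_pole[OF inverse(2)], rule that)
    \<comment> \<open>Beyond \<open>R'\<close>, a point u with image in \<open>T\<close> has |tan u|
      > \<open>R1\<close>, hence a pole p within \<open>\<rho>\<close>, and p is so far away that
      the local inverse at p is defined on all of \<open>T\<close>.\<close>
    define R' where "R' = \<bar>R1\<bar> + 1 / \<epsilon> + \<rho> + cmod lam + R"
    have bounded: "cmod u \<le> R'" if u: "u \<in> P - G" "tan_shift lam u \<in> ball b r" for u
    proof (rule ccontr)
      assume "\<not> cmod u \<le> R'"
      then have big: "cmod u > R'" by simp
      have FuT: "tan_shift lam u \<in> T" using u(2) T(3) by blast
      have "cmod u \<le> cmod (tan_shift lam u) + cmod lam + cmod (tan u)"
        using norm_triangle_ineq4[of "tan_shift lam u - lam" "tan u"] norm_triangle_ineq4[of "tan_shift lam u" lam]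
        by (simp add: tan_shift_def)
      then have "R1 < cmod (tan u)" using big R[OF FuT] inverse(1,2) zero_less_divide_1_iff[of \<epsilon>]
        unfolding R'_def by linarith
      moreover have cu: "cos u \<noteq> 0" using u(1) by (simp add: P_def)
      ultimately obtain p where p: "cos p = 0" "cmod (u - p) < \<rho>" using R1 by blast
      have far: "1 / \<epsilon> < cmod (w - lam - p)" if "w \<in> T" for w
      proof -
        have "cmod u \<le> cmod (w - lam - p) + cmod w + cmod lam + cmod (u - p)"
          using norm_triangle_ineq4[of w "w - lam - p"] norm_triangle_ineq4[of "w - (w - lam - p)" lam]
            norm_triangle_ineq[of p "u - p"] by simp
        then show ?thesis using big R[OF that] p(2) unfolding R'_def by linarith
      qed
      \<comment> \<open>\<open>g\<close> is the branch of the inverse of f on \<open>T\<close> that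
        sends f(u) back to u.\<close>
      define g where "g = (\<lambda>w. p + \<theta> (1 / (w - lam - p)))"
      have ball: "1 / (w - lam - p) \<in> ball 0 \<epsilon> \<and> w - lam - p \<noteq> 0" if "w \<in> T" for w
      proof -
        have "0 < cmod (w - lam - p)" using far[OF that] inverse(1) by (meson divide_pos_pos less_trans zero_less_one)
        then show ?thesis using far[OF that] inverse(1) by (auto simp: norm_divide field_simps)
      qed
      have "continuous_on T (\<lambda>w. 1 / (w - lam - p))"
        using ball by (intro continuous_intros) auto
      then have "continuous_on T g"
        unfolding g_def using ball
        by (intro continuous_intros continuous_on_compose2[OF inverse(3)]) auto
      then have "connected (g ` T)" using connT connected_continuous_image by blast
      moreover have gP: "g w \<in> P \<and> tan_shift lam (g w) = w" if "w \<in> T" for w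
        using right[OF p(1) far[OF that]] that T(2) by (auto simp: P_def g_def)
      moreover have "g s \<in> G" using gP[OF bs(2)] s pre by (auto simp: P_def)
      ultimately have "g ` T \<subseteq> G" using PA bs(2) by (intro absorb) auto
      moreover have "g (tan_shift lam u) = u"
        using left[OF p(1), of "u - p" lam] p(2) cu far[OF FuT] by (simp add: g_def)
      ultimately show False using u(1) FuT by (metis DiffD2 image_subset_iff)
    qed
    have "\<exists>u. u \<in> P - G \<and> dist b (tan_shift lam u) < min r (inverse (real (Suc n)))" for n
    proof -
      define e where "e = min r (inverse (real (Suc n)))"
      have e: "e > 0" using r(1) by (simp add: e_def)
      then obtain w where "w \<in> ball b e" "w \<notin> G - I" using no by blast
      moreover have "ball b e \<subseteq> G" using r(2) by (force simp: e_def)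
      ultimately have "w \<in> I" by blast
      then show ?thesis using \<open>w \<in> ball b e\<close> by (auto simp: I_def e_def)
    qed
    then obtain u where u: "\<And>n. u n \<in> P - G" "\<And>n. dist b (tan_shift lam (u n)) < min r (inverse (real (Suc n)))"
      by metis
    have "u n \<in> cball 0 R'" for n using bounded[OF u(1), of n] u(2)[of n] by simp
    then obtain l \<phi> where \<phi>: "strict_mono (\<phi> :: nat \<Rightarrow> nat)" "(u \<circ> \<phi>) \<longlonglongrightarrow> l"
      using compact_cball[of 0 R'] unfolding compact_def by metis
    have "(\<lambda>n. dist (tan_shift lam (u n)) b) \<longlonglongrightarrow> 0"
      by (rule tendsto_sandwich[OF _ _ tendsto_const LIMSEQ_inverse_real_of_nat])
        (use u(2) in \<open>auto simp: dist_commute less_imp_le\<close>)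
    then have "(\<lambda>n. tan_shift lam (u n)) \<longlonglongrightarrow> b" by (rule tendsto_dist_iff[THEN iffD2])
    then have "(\<lambda>n. tan_shift lam ((u \<circ> \<phi>) n)) \<longlonglongrightarrow> b"
      using LIMSEQ_subseq_LIMSEQ[OF _ \<phi>(1)] unfolding o_def by blast
    then have l: "cos l \<noteq> 0" "tan_shift lam l = b"
      using tan_shift_limit_point[OF \<phi>(2)] u(1) by (auto simp: P_def)
    have "l \<notin> G"
    proof
      assume "l \<in> G"
      then have "\<forall>\<^sub>F n in sequentially. (u \<circ> \<phi>) n \<in> G" using \<phi>(2) openG topological_tendstoD by blast
      then obtain n where "(u \<circ> \<phi>) n \<in> G" using eventually_happens' sequentially_bot by blast
      then show False using u(1) by auto
    qed
    then have "b \<in> I" using l b by (auto simp: I_def P_def)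
    then show False using b by blast
  qed
  have "I = {}"
  proof (rule ccontr)
    assume "I \<noteq> {}"
    moreover have "G - I \<noteq> {}" using G(2) \<open>I \<inter> half_plane = {}\<close> half_plane_nonempty by blast
    ultimately show False
      using connectedD[OF connG \<open>open I\<close> \<open>open (G - I)\<close>] \<open>I \<subseteq> G\<close> by blast
  qed
  then have backward: "cos z \<noteq> 0 \<Longrightarrow> tan_shift lam z \<in> G \<Longrightarrow> z \<in> G" for z
    by (auto simp: I_def P_def)
  have "regular lam n z \<Longrightarrow> (tan_shift lam ^^ n) z \<in> half_plane \<Longrightarrow> z \<in> G" for n z
  proof (induction n arbitrary: z)
    case 0
    then show ?case using G(2) by auto
  next
    case (Suc n)
    then show ?case using backward by (auto simp: regular_Suc_left funpow_swap1)
  qed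
  then have "attracted \<subseteq> G" by (auto simp: basin_def)
  then show ?thesis using subG connG by (metis subset_antisym)
qed

subsection \<open>The two half-planes\<close>

text \<open>Each set \<open>T\<close> puts its preimage point into the component containing the
  half-plane, so only first preimages of the half-plane have to be examined geometrically.\<close>

lemma (in escaping_half_plane) attracted_connectedI:
  assumes "\<And>z. cos z \<noteq> 0 \<Longrightarrow> tan_shift lam z \<in> half_plane \<Longrightarrow>
    \<exists>T. connected T \<and> T \<subseteq> attracted \<and> z \<in> T \<and> T \<inter> half_plane \<noteq> {}"
  shows "connected attracted"
proof -
  obtain G where G: "G \<in> components attracted" "half_plane \<subseteq> G"
    using exists_component_superset[OF subset_basin[of half_plane lam] _ connected_half_plane]
      half_plane_nonempty subset_basin[of half_plane lam] by blast
  show ?thesis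
  proof (rule attracted_connected[OF G])
    fix z assume "cos z \<noteq> 0" "tan_shift lam z \<in> half_plane"
    then obtain T where "connected T" "T \<subseteq> attracted" "z \<in> T" "T \<inter> half_plane \<noteq> {}"
      using assms by blast
    then show "z \<in> G" using components_maximal[OF G(1), of T] G(2) by blast
  qed
qed

text \<open>This detects parts of the basin outside the half-plane; the drift \<open>e\<close> on
  \<open>D\<close> is unrelated to \<open>\<delta>\<close>.\<close>

lemma (in escaping_half_plane) escaping_invariant_subset_attracted:
  assumes "e > 0"
    and D: "\<And>z. z \<in> D \<Longrightarrow> cos z \<noteq> 0 \<and> tan_shift lam z \<in> D \<and> \<sigma> * Im z + e \<le> \<sigma> * Im (tan_shift lam z)"
  shows "D \<subseteq> attracted"
proof
  fix z assume z: "z \<in> D"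
  have *: "regular lam n z \<and> (tan_shift lam ^^ n) z \<in> D \<and>
      \<sigma> * Im z + n * e \<le> \<sigma> * Im ((tan_shift lam ^^ n) z)" for n
  proof (induction n)
    case (Suc n)
    then show ?case using D[of "(tan_shift lam ^^ n) z"] by (auto simp: regular_Suc algebra_simps)
  qed (simp add: z)
  obtain n :: nat where "M - \<sigma> * Im z < n * e" using reals_Archimedean3[OF assms(1)] by blast
  then show "z \<in> attracted" using *[of n] by (auto simp: basin_def intro!: exI[of _ n])
qed

lemma cos_complex_nonzero_iff: "cos z \<noteq> 0 \<longleftrightarrow> 0 < cos (2 * Re z) + cosh (2 * Im z)" for z :: complex
  using cos_plus_cosh_pos cmod_cos_squared[of z] by auto

lemma sinh_cosh_quotient_bounds:
  fixes y c :: real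
  assumes "0 \<le> y" "- 1 \<le> c" "c \<le> 1" "0 < c + cosh (2 * y)"
  shows "tanh y \<le> sinh (2 * y) / (c + cosh (2 * y))"
    and "0 < y \<Longrightarrow> sinh (2 * y) / (c + cosh (2 * y)) \<le> cosh y / sinh y"
proof -
  have "sinh (2 * y) / (1 + cosh (2 * y)) \<le> sinh (2 * y) / (c + cosh (2 * y))"
    using assms by (intro divide_left_mono) auto
  then show "tanh y \<le> sinh (2 * y) / (c + cosh (2 * y))"
    by (simp add: sinh_double_over_cosh_double)
  assume "0 < y"
  then have "0 < cosh (2 * y) - 1" using cosh_double_gt_one[of y] by simp
  then have "sinh (2 * y) / (c + cosh (2 * y)) \<le> sinh (2 * y) / (cosh (2 * y) - 1)"
    using assms by (intro divide_left_mono mult_pos_pos) auto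
  then show "sinh (2 * y) / (c + cosh (2 * y)) \<le> cosh y / sinh y"
    using \<open>0 < y\<close> by (simp add: sinh_double_over_cosh_double)
qed

lemma neg_Im_tan_shift:
  assumes "cos z \<noteq> 0"
  shows "- Im (tan_shift lam z) =
    - Im z + sinh (2 * - Im z) / (cos (2 * Re z) + cosh (2 * - Im z)) - Im lam"
  by (simp add: tan_shift_parts[OF assms])

lemma Im_tan_shift_ge:
  assumes "0 \<le> Im z" "cos z \<noteq> 0"
  shows "Im z + Im lam \<le> Im (tan_shift lam z)"
  using assms cos_plus_cosh_pos[OF assms(2)] by (simp add: tan_shift_parts)

lemma upper_escaping: "0 < Im lam \<Longrightarrow> escaping_half_plane lam 1 0 (Im lam)"
  by unfold_locales (use Im_tan_shift_ge cos_complex_nonzero in auto)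

text \<open>Below height -M the imaginary part of \<open>tan\<close> is less than - tanh M, which
  outweighs the upward shift by Im lam.\<close>

lemma lower_escaping:
  assumes "0 \<le> M" "Im lam < tanh M"
  shows "escaping_half_plane lam (- 1) M (tanh M - Im lam)"
proof
  fix z assume z: "M < - 1 * Im z"
  have "cos z \<noteq> 0" using z assms by (intro cos_complex_nonzero) auto
  then have "tanh (- Im z) \<le> sinh (2 * - Im z) / (cos (2 * Re z) + cosh (2 * - Im z))"
    using z assms(1) by (intro sinh_cosh_quotient_bounds) (auto simp: cos_complex_nonzero_iff)
  moreover have "tanh M \<le> tanh (- Im z)" using z by (simp only: tanh_real_le_iff)
  ultimately show "- 1 * Im z + (tanh M - Im lam) \<le> - 1 * Im (tan_shift lam z)"
    using neg_Im_tan_shift[OF \<open>cos z \<noteq> 0\<close>, of lam] by linarith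
qed (use assms in auto)

lemma cos_double_mono:
  fixes x x' :: real
  assumes "\<bar>x'\<bar> \<le> \<bar>x\<bar>" "\<bar>x\<bar> \<le> pi / 2"
  shows "cos (2 * x) \<le> cos (2 * x')"
proof -
  have "cos (2 * \<bar>x\<bar>) \<le> cos (2 * \<bar>x'\<bar>)" using assms by (intro cos_monotone_0_pi_le) auto
  then show ?thesis by (cases "x \<ge> 0"; cases "x' \<ge> 0") auto
qed

lemma closed_segment_real_abs:
  fixes a x w :: real
  assumes "w \<in> closed_segment x a"
  shows "\<bar>w - a\<bar> \<le> \<bar>x - a\<bar>"
  using assms by (auto simp: closed_segment_eq_real_ivl split: if_splits)

text \<open>From a point z on or below the real axis with f(z) in the upper half-plane, go
  horizontally to the nearest vertical line through a zero of \<open>tan\<close>, then straight up.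
  On the first segment cos (2 Re) grows, so the downward pull of \<open>tan\<close> weakens; on the
  second the image has height Im lam + y + tanh y at height y, which increases. So f maps the whole
  path into the upper half-plane.\<close>

lemma upper_attracted_connected:
  assumes "0 < Im lam"
  shows "connected (basin lam {z. 0 < Im z})"
proof -
  interpret escaping_half_plane lam 1 0 "Im lam" by (rule upper_escaping[OF assms])
  have pre: "w \<in> attracted" if "cos w \<noteq> 0" "0 < Im (tan_shift lam w)" for w
    using that basin_backward[of w lam half_plane] subset_basin[of half_plane lam] by auto
  have "connected attracted"
  proof (rule attracted_connectedI)
    fix z assume z: "cos z \<noteq> 0" "tan_shift lam z \<in> half_plane"
    show "\<exists>T. connected T \<and> T \<subseteq> attracted \<and> z \<in> T \<and> T \<inter> half_plane \<noteq> {}"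
    proof (cases "0 < Im z")
      case True
      then show ?thesis using subset_basin[of half_plane lam] by (intro exI[of _ "{z}"]) auto
    next
      case False
      define Y where "Y = - Im z"
      have Y: "0 \<le> Y" using False by (simp add: Y_def)
      obtain m :: int where m: "\<bar>Re z - 0 - of_int m * pi\<bar> \<le> pi / 2" by (rule nearest_of_int_pi)
      define a where "a = of_int m * pi"
      have c: "cos (2 * (x - a)) = cos (2 * x)" for x
        unfolding a_def by (rule sin_cos_double_of_int_pi)
      have q: "0 < cos (2 * Re z) + cosh (2 * Y)" using z(1) by (simp add: cos_complex_nonzero_iff Y_def)
      have Fz: "Y + sinh (2 * Y) / (cos (2 * Re z) + cosh (2 * Y)) < Im lam"
        using z by (simp add: Y_def neg_Im_tan_shift flip: neg_less_0_iff_less[of "Im (tan_shift lam z)"])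
      define T where "T = closed_segment z (Complex a (- Y)) \<union> closed_segment (Complex a (- Y)) (Complex a 1)"
      have "connected T"
        unfolding T_def by (rule connected_Un) (auto simp: ends_in_segment)
      moreover have "w \<in> attracted" if w: "w \<in> closed_segment z (Complex a (- Y))" for w
      proof -
        have "Im w = - Y" "Re w \<in> closed_segment (Re z) a"
          using w closed_segment_same_Im[of z "Complex a (- Y)"] by (auto simp: Y_def)
        then have "cos (2 * (Re z - a)) \<le> cos (2 * (Re w - a))"
          using m by (intro cos_double_mono closed_segment_real_abs) (auto simp: a_def)
        then have le: "cos (2 * Re z) \<le> cos (2 * Re w)" by (simp only: c)
        then have nz: "cos w \<noteq> 0" using q \<open>Im w = - Y\<close> by (simp add: cos_complex_nonzero_iff)
        have "sinh (2 * Y) / (cos (2 * Re w) + cosh (2 * Y)) \<le> sinh (2 * Y) / (cos (2 * Re z) + cosh (2 * Y))"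
          using le q Y by (intro divide_left_mono mult_pos_pos) auto
        then have "- Im (tan_shift lam w) < 0"
          using Fz \<open>Im w = - Y\<close> by (simp add: neg_Im_tan_shift[OF nz])
        then show ?thesis using pre[OF nz] by simp
      qed
      moreover have "w \<in> attracted" if w: "w \<in> closed_segment (Complex a (- Y)) (Complex a 1)" for w
      proof -
        have Re: "Re w = a" and Im: "- Y \<le> Im w"
          using w Y closed_segment_same_Re[of "Complex a (- Y)" "Complex a 1"]
          by (auto simp: closed_segment_eq_real_ivl split: if_splits)
        have "cos (2 * Re w) = 1" using c[of a] by (simp add: Re)
        then have nz: "cos w \<noteq> 0" by (simp add: cos_complex_nonzero_iff add_pos_pos)
        have Imw: "Im (tan_shift lam w) = Im lam + Im w + tanh (Im w)"
          using tan_shift_parts(2)[OF nz] \<open>cos (2 * Re w) = 1\<close> by (simp add: sinh_double_over_cosh_double)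
        have "tanh Y \<le> sinh (2 * Y) / (cos (2 * Re z) + cosh (2 * Y))"
          using Y q by (intro sinh_cosh_quotient_bounds) auto
        moreover have "tanh (- Y) \<le> tanh (Im w)" using Im by (simp only: tanh_real_le_iff)
        ultimately have "0 < Im (tan_shift lam w)" using Fz Im unfolding Imw by simp
        then show ?thesis using pre[OF nz] by simp
      qed
      ultimately have "connected T \<and> T \<subseteq> attracted" by (auto simp: T_def)
      moreover have "z \<in> T" by (simp add: T_def)
      moreover have "Complex a 1 \<in> T \<inter> half_plane" by (simp add: T_def)
      ultimately show ?thesis by blast
    qed
  qed
  then show ?thesis by simp
qed

text \<open>With Re lam a multiple of pi, f permutes neither real parts nor heights in general, but
  it sends each open ray below a pole into a vertical line through a pole.\<close>

locale two_baker_domains =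
  fixes lam :: complex and M :: real and k :: int
  assumes Im_lam: "0 < Im lam" "Im lam < tanh M" and Re_lam: "Re lam = of_int k * pi"
begin

lemma M_pos: "0 < M"
  using Im_lam by (metis less_trans tanh_real_pos_iff)

lemma Im_lam_less_one: "Im lam < 1"
  using Im_lam(2) tanh_real_lt_1[of M] by linarith

sublocale lower: escaping_half_plane lam "- 1" M "tanh M - Im lam"
  using M_pos Im_lam by (intro lower_escaping) auto

text \<open>On these rays sin (2 Re z) = 0, so the real part moves by a multiple of pi, to another
  ray of the same kind. The imaginary part of \<open>tan\<close> is - coth (- Im z) < -1, so each
  step descends by at least 1 - Im lam.\<close>

lemma below_pole_attracted:
  assumes "cos (2 * Re z) = - 1" "Im z < 0"
  shows "z \<in> lower.attracted"
proof -
  have "{z. cos (2 * Re z) = - 1 \<and> Im z < 0} \<subseteq> lower.attracted"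
  proof (rule lower.escaping_invariant_subset_attracted[of "1 - Im lam"])
    fix z assume "z \<in> {z. cos (2 * Re z) = - 1 \<and> Im z < 0}"
    then have z: "cos (2 * Re z) = - 1" "Im z < 0" by auto
    then have nz: "cos z \<noteq> 0" by (intro cos_complex_nonzero) auto
    have "(sin (2 * Re z))\<^sup>2 = 0" using z(1) by (simp add: sin_squared_eq)
    then have "Re (tan_shift lam z) = Re z - of_int (- k) * pi"
      using tan_shift_parts(1)[OF nz, of lam] Re_lam by simp
    then have "cos (2 * Re (tan_shift lam z)) = - 1"
      using sin_cos_double_of_int_pi(1)[of "Re z" "- k"] z(1) by (simp only:)
    moreover have "1 < cosh (- Im z) / sinh (- Im z)"
      using z(2) sinh_less_cosh_real[of "- Im z"] by (simp add: divide_simps del: sinh_minus cosh_minus)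
    then have "- Im z + (1 - Im lam) \<le> - Im (tan_shift lam z)"
      unfolding neg_Im_tan_shift[OF nz] z(1)
      using sinh_double_over_cosh_double(2)[of "- Im z"] z(2) by (simp only: add.commute[of "- 1"] flip: diff_conv_add_uminus)
    ultimately show "cos z \<noteq> 0 \<and> tan_shift lam z \<in> {z. cos (2 * Re z) = - 1 \<and> Im z < 0} \<and>
        - 1 * Im z + (1 - Im lam) \<le> - 1 * Im (tan_shift lam z)"
      using nz z(2) Im_lam_less_one by auto
  qed (use Im_lam_less_one in simp)
  then show ?thesis using assms by blast
qed

lemma cos_double_shift_half_pi:
  fixes x :: real
  shows "cos (2 * (x - pi / 2 - of_int m * pi)) = - cos (2 * x)"
    and "sin (2 * (x - pi / 2 - of_int m * pi)) = - sin (2 * x)"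
  using sin_cos_double_of_int_pi[of "x - pi / 2" m]
  by (simp_all add: right_diff_distrib cos_diff sin_diff)

text \<open>
  Where the derivative of \<open>f\<close> is at most one in modulus, the orbit is funnelled
  towards the vertical line below the nearest pole and descends.
\<close>

lemma contracting_region_attracted:
  assumes "cos (2 * Re z) * cosh (2 * Im z) \<le> - 2" "Im z < 0"
  shows "z \<in> lower.attracted"
proof -
  let ?D = "{z. cos (2 * Re z) * cosh (2 * Im z) \<le> - 2 \<and> Im z < 0}"
  have "?D \<subseteq> lower.attracted"
  proof (rule lower.escaping_invariant_subset_attracted[of "1 - Im lam"])
    fix z assume "z \<in> ?D"
    then have z: "cos (2 * Re z) * cosh (2 * Im z) \<le> - 2" "Im z < 0" by auto
    then have nz: "cos z \<noteq> 0" by (intro cos_complex_nonzero) auto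
    define y where "y = - Im z"
    define H where "H = cosh (2 * y)"
    obtain m :: int where m: "\<bar>Re z - pi / 2 - of_int m * pi\<bar> \<le> pi / 2" by (rule nearest_of_int_pi)
    define \<xi> where "\<xi> = Re z - pi / 2 - of_int m * pi"
    define c where "c = cos (2 * \<xi>)"
    have Cz: "cos (2 * Re z) = - c" and Sz: "sin (2 * Re z) = - sin (2 * \<xi>)"
      unfolding c_def \<xi>_def by (simp_all only: cos_double_shift_half_pi minus_minus)
    have H1: "1 \<le> H" by (simp add: H_def cosh_real_ge_1)
    have cH: "2 \<le> c * H" using z(1) by (simp add: Cz H_def y_def)
    have c1: "c \<le> 1" by (simp add: c_def)
    have c0: "0 < c" using cH H1 by (smt (verit) mult_nonpos_nonneg)
    have H2: "2 \<le> H" using cH c1 H1 mult_right_mono[of c 1 H] by linarith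
    have y: "0 < y" using z(2) by (simp add: y_def)
    define d where "d = sin (2 * \<xi>) / (H - c)"
    have "\<bar>d\<bar> \<le> \<bar>2 * \<xi>\<bar> / 1"
      unfolding d_def abs_divide using H2 c1 by (intro frac_le) (auto intro: abs_sin_x_le_abs_x)
    have pi2: "\<bar>2 * \<xi>\<bar> \<le> pi" using m unfolding \<xi>_def[symmetric] abs_mult by simp
    \<comment> \<open>The horizontal move \<open>d\<close> has the sign of \<open>\<xi>\<close> and
      at most twice its size because H - c >= 1, so the distance to the vertical line through a pole
      does not increase.\<close>
    have "\<bar>\<xi> - d\<bar> \<le> \<bar>\<xi>\<bar>"
    proof (cases "0 \<le> \<xi>")
      case True
      then have "0 \<le> d" unfolding d_def using pi2 H2 c1 by (intro divide_nonneg_nonneg sin_ge_zero) auto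
      with True \<open>\<bar>d\<bar> \<le> \<bar>2 * \<xi>\<bar> / 1\<close> show ?thesis by auto
    next
      case False
      have "0 \<le> - d" unfolding d_def minus_divide_left sin_minus[symmetric]
        using False pi2 H2 c1 by (intro divide_nonneg_nonneg sin_ge_zero) auto
      with False \<open>\<bar>d\<bar> \<le> \<bar>2 * \<xi>\<bar> / 1\<close> show ?thesis by auto
    qed
    then have c': "c \<le> cos (2 * (\<xi> - d))"
      unfolding c_def using m by (intro cos_double_mono) (auto simp: \<xi>_def)
    have "Re (tan_shift lam z) - pi / 2 - of_int (m + k) * pi = \<xi> - d"
      using tan_shift_parts(1)[OF nz, of lam] Re_lam
      by (simp add: \<xi>_def[symmetric] d_def H_def y_def Cz Sz) (simp add: \<xi>_def algebra_simps)
    then have C': "cos (2 * Re (tan_shift lam z)) = - cos (2 * (\<xi> - d))"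
      using cos_double_shift_half_pi(1)[of "Re (tan_shift lam z)" "m + k"] by simp
    \<comment> \<open>This says that the imaginary part of \<open>tan\<close> at z is at most -1. It
      follows from c >= 2 / H, since (H - 2 / H)^2 <= H^2 - 3.\<close>
    have "H - c \<le> sinh (2 * y)"
    proof (rule power2_le_imp_le)
      have "2 / H \<le> c" using cH H1 by (simp add: field_simps)
      moreover have "0 \<le> H - c" using H2 c1 by linarith
      ultimately have "(H - c)\<^sup>2 \<le> (H - 2 / H)\<^sup>2" by (intro power_mono) auto
      also have "\<dots> = H\<^sup>2 - 4 + (2 / H)\<^sup>2" using H2 by (simp add: power2_diff)
      also have "\<dots> \<le> H\<^sup>2 - 4 + 1\<^sup>2" using H2 by (intro add_left_mono power_mono) auto
      also have "\<dots> \<le> (sinh (2 * y))\<^sup>2" by (simp add: sinh_square_eq H_def)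
      finally show "(H - c)\<^sup>2 \<le> (sinh (2 * y))\<^sup>2" .
    qed (use y in simp)
    then have "1 \<le> sinh (2 * y) / (- c + H)" using H2 c1 by (simp add: field_simps)
    then have y': "y + (1 - Im lam) \<le> - Im (tan_shift lam z)"
      using neg_Im_tan_shift[OF nz, of lam] by (simp add: y_def[symmetric] Cz H_def[symmetric])
    then have yle: "y \<le> - Im (tan_shift lam z)" using Im_lam_less_one by linarith
    then have "H \<le> cosh (2 * - Im (tan_shift lam z))"
      unfolding H_def using y by (subst cosh_real_nonneg_le_iff) auto
    then have "c * H \<le> cos (2 * (\<xi> - d)) * cosh (2 * - Im (tan_shift lam z))"
      using c' c0 H1 by (intro mult_mono) auto
    then have "cos (2 * Re (tan_shift lam z)) * cosh (2 * Im (tan_shift lam z)) \<le> - 2"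
      using cH by (simp add: C')
    moreover have "Im (tan_shift lam z) < 0" using yle y by linarith
    ultimately show "cos z \<noteq> 0 \<and> tan_shift lam z \<in> ?D \<and>
        - 1 * Im z + (1 - Im lam) \<le> - 1 * Im (tan_shift lam z)"
      using nz y' by (simp add: y_def)
  qed (use Im_lam_less_one in simp)
  then show ?thesis using assms by blast
qed

text \<open>Here the path goes horizontally to the ray below the nearest pole and then down that
  ray. On the first segment cos (2 Re) decreases and \<open>tan\<close> pulls further down, so
  images stay in the half-plane; the ray is in the basin by
  \<open>below_pole_attracted\<close>.\<close>

lemma lower_attracted_connected: "connected lower.attracted"
proof (rule lower.attracted_connectedI)
  fix z assume z: "cos z \<noteq> 0" "tan_shift lam z \<in> lower.half_plane"
  have pre: "w \<in> lower.attracted" if "cos w \<noteq> 0" "M < - Im (tan_shift lam w)" for w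
    using that basin_backward[of w lam lower.half_plane] subset_basin[of lower.half_plane lam] by auto
  have "Im z < 0"
    using z Im_tan_shift_ge[of z lam] Im_lam M_pos by (cases "Im z < 0") auto
  define y where "y = - Im z"
  have y: "0 < y" using \<open>Im z < 0\<close> by (simp add: y_def)
  have Fz: "M < y + sinh (2 * y) / (cos (2 * Re z) + cosh (2 * y)) - Im lam"
    using z(2) neg_Im_tan_shift[OF z(1), of lam] by (simp add: y_def)
  obtain m :: int where m: "\<bar>Re z - pi / 2 - of_int m * pi\<bar> \<le> pi / 2" by (rule nearest_of_int_pi)
  define a where "a = pi / 2 + of_int m * pi"
  define Y where "Y = max y (M + 1)"
  define T where "T = closed_segment z (Complex a (- y)) \<union> closed_segment (Complex a (- y)) (Complex a (- Y))"
  have c: "cos (2 * (x - a)) = - cos (2 * x)" for x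
    using cos_double_shift_half_pi(1)[of x m] by (simp add: a_def algebra_simps)
  have "connected T"
    unfolding T_def by (rule connected_Un) (auto simp: ends_in_segment)
  moreover have "w \<in> lower.attracted" if w: "w \<in> closed_segment z (Complex a (- y))" for w
  proof -
    have Im: "Im w = - y" and "Re w \<in> closed_segment (Re z) a"
      using w closed_segment_same_Im[of z "Complex a (- y)"] by (auto simp: y_def)
    then have "cos (2 * (Re z - a)) \<le> cos (2 * (Re w - a))"
      using m by (intro cos_double_mono closed_segment_real_abs) (auto simp: a_def algebra_simps)
    then have le: "cos (2 * Re w) \<le> cos (2 * Re z)" by (simp only: c neg_le_iff_le)
    have nz: "cos w \<noteq> 0" using Im y by (intro cos_complex_nonzero) auto
    then have "0 < cos (2 * Re w) + cosh (2 * y)" using Im by (simp add: cos_complex_nonzero_iff)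
    then have "sinh (2 * y) / (cos (2 * Re z) + cosh (2 * y)) \<le> sinh (2 * y) / (cos (2 * Re w) + cosh (2 * y))"
      using le y by (intro divide_left_mono mult_pos_pos) auto
    then have "M < - Im (tan_shift lam w)"
      using Fz Im by (simp add: neg_Im_tan_shift[OF nz])
    then show ?thesis using pre[OF nz] by simp
  qed
  moreover have "w \<in> lower.attracted" if w: "w \<in> closed_segment (Complex a (- y)) (Complex a (- Y))" for w
  proof (rule below_pole_attracted)
    have "Re w = a" "Im w \<le> - y"
      using w y closed_segment_same_Re[of "Complex a (- y)" "Complex a (- Y)"]
      by (auto simp: closed_segment_eq_real_ivl Y_def split: if_splits)
    then show "cos (2 * Re w) = - 1" "Im w < 0" using c[of a] y by auto
  qed
  ultimately have "connected T \<and> T \<subseteq> lower.attracted" by (auto simp: T_def)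
  moreover have "z \<in> T" by (simp add: T_def)
  moreover have "Complex a (- Y) \<in> T \<inter> lower.half_plane" by (simp add: T_def Y_def)
  ultimately show "\<exists>T. connected T \<and> T \<subseteq> lower.attracted \<and> z \<in> T \<and> T \<inter> lower.half_plane \<noteq> {}" by blast
qed

end

subsection \<open>Expansion\<close>

text \<open>The Cayley map w -> (w - b) / (w - cnj b) takes the lower half-plane to the unit disc
  and b = h(z0) to 0; Schwarz's lemma then bounds the derivative at the centre.\<close>

lemma schwarz_pick_lower_half_plane:
  assumes r: "0 < r" and h: "h holomorphic_on ball z0 r"
    and neg: "\<And>z. z \<in> ball z0 r \<Longrightarrow> Im (h z) < 0"
    and D: "(h has_field_derivative D) (at z0)"
  shows "cmod D * r \<le> 2 * - Im (h z0)"
proof -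
  define b where "b = h z0"
  have b: "Im b < 0" using neg r by (simp add: b_def)
  define g where "g = (\<lambda>u. (h (z0 + of_real r * u) - b) / (h (z0 + of_real r * u) - cnj b))"
  have in_ball: "z0 + of_real r * u \<in> ball z0 r" if "u \<in> ball 0 1" for u
    using that r by (simp add: dist_norm norm_mult)
  have nz: "w - cnj b \<noteq> 0" if "Im w < 0" for w
    using that b by (auto simp: complex_eq_iff)
  have closer: "cmod (w - b) < cmod (w - cnj b)" if "Im w < 0" for w
  proof (rule power2_less_imp_less)
    have "(cmod (w - cnj b))\<^sup>2 - (cmod (w - b))\<^sup>2 = 4 * (Im w * Im b)"
      unfolding cmod_power2 by (simp add: power2_eq_square algebra_simps)
    then show "(cmod (w - b))\<^sup>2 < (cmod (w - cnj b))\<^sup>2"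
      using mult_neg_neg[OF that b] by linarith
  qed simp
  have "(h \<circ> (\<lambda>u. z0 + of_real r * u)) holomorphic_on ball 0 1"
    using in_ball by (intro holomorphic_on_compose_gen[OF _ h] holomorphic_intros) auto
  then have hol: "g holomorphic_on ball 0 1"
    unfolding g_def o_def using nz neg[OF in_ball] by (intro holomorphic_intros) auto
  have g1: "cmod (g u) < 1" if "cmod u < 1" for u
  proof -
    have "Im (h (z0 + of_real r * u)) < 0" using that by (intro neg in_ball) simp
    with closer[OF this] nz[OF this] show ?thesis by (simp add: g_def norm_divide)
  qed
  have g0: "g 0 = 0" by (simp add: g_def b_def)
  have hr: "((\<lambda>u. h (z0 + of_real r * u)) has_field_derivative D * of_real r) (at 0)"
    by (rule DERIV_chain2[of h D "\<lambda>u. z0 + of_real r * u"]) (auto intro!: derivative_eq_intros D)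
  have "(g has_field_derivative D * of_real r / (b - cnj b)) (at 0)"
    unfolding g_def
    by (rule derivative_eq_intros hr refl | use nz[OF b] in \<open>simp add: b_def[symmetric]\<close>)+
  then have "deriv g 0 = D * of_real r / (b - cnj b)" by (rule DERIV_imp_deriv)
  moreover have "cmod (deriv g 0) \<le> 1" by (rule Schwarz_Lemma(2)[OF hol g0 g1, of 0]) simp_all
  moreover have "b - cnj b = of_real (2 * Im b) * \<i>" by (simp add: complex_eq_iff)
  ultimately have "cmod D * r / (2 * - Im b) \<le> 1"
    using b r by (simp add: norm_divide norm_mult)
  then show ?thesis using b by (simp add: b_def[symmetric] field_simps)
qed

definition multiplier :: "complex \<Rightarrow> nat \<Rightarrow> complex \<Rightarrow> complex" where
  "multiplier lam n z = (\<Prod>k<n. 1 + 1 / (cos ((tan_shift lam ^^ k) z))\<^sup>2)"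

lemma tan_shift_funpow_has_field_derivative:
  "regular lam n z \<Longrightarrow> ((tan_shift lam ^^ n) has_field_derivative multiplier lam n z) (at z)"
proof (induction n)
  case (Suc n)
  then have "regular lam n z" "cos ((tan_shift lam ^^ n) z) \<noteq> 0" by (simp_all add: regular_Suc)
  then have "((tan_shift lam \<circ> (tan_shift lam ^^ n)) has_field_derivative
      (1 + 1 / (cos ((tan_shift lam ^^ n) z))\<^sup>2) * multiplier lam n z) (at z)"
    by (intro DERIV_chain tan_shift_has_field_derivative Suc.IH)
  then show ?case by (simp add: multiplier_def mult.commute o_def)
qed (simp add: multiplier_def id_def)

lemma multiplier_bound:
  assumes "0 < r" and reg: "\<And>z n. z \<in> ball z0 r \<Longrightarrow> regular lam n z"
    and neg: "\<And>z. z \<in> ball z0 r \<Longrightarrow> Im ((tan_shift lam ^^ n) z) < 0"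
  shows "cmod (multiplier lam n z0) * r \<le> 2 * - Im ((tan_shift lam ^^ n) z0)"
proof (rule schwarz_pick_lower_half_plane[OF assms(1) _ neg])
  show "(tan_shift lam ^^ n) holomorphic_on ball z0 r"
    using reg by (intro holomorphic_on_subset[OF holomorphic_tan_shift_funpow]) auto
  show "((tan_shift lam ^^ n) has_field_derivative multiplier lam n z0) (at z0)"
    using reg[of z0] assms(1) by (intro tan_shift_funpow_has_field_derivative) simp
qed

text \<open>Strictness holds because a real point that is not a pole is lifted into the upper
  half-plane by the next step.\<close>

lemma not_upper_attracted:
  assumes "0 < Im lam" and reg: "\<And>n. regular lam n z" and "z \<notin> basin lam {z. 0 < Im z}"
  shows "Im ((tan_shift lam ^^ n) z) < 0"
proof -
  have le: "Im ((tan_shift lam ^^ n) z) \<le> 0" for n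
    using assms(3) reg[of n] by (auto simp: basin_def not_less)
  have "cos ((tan_shift lam ^^ n) z) \<noteq> 0" using reg[of "Suc n"] by (simp add: regular_Suc)
  then show ?thesis
    using Im_tan_shift_ge[of "(tan_shift lam ^^ n) z" lam] le[of n] le[of "Suc n"] assms(1) by fastforce
qed

text \<open>Both formulas come from f' = (3 + cos 2z) / (2 (cos z)^2). The first matches the
  radicand in \<open>half_plane_expansion_real\<close>; the second shows that |f'| <= 1 exactly if C
  * H <= -2.\<close>

lemma tan_shift_derivative_norm:
  fixes z :: complex
  defines "C \<equiv> cos (2 * Re z)" and "H \<equiv> cosh (2 * Im z)" and "S \<equiv> sinh (2 * Im z)"
  assumes "cos z \<noteq> 0"
  shows "(cmod (1 + 1 / (cos z)\<^sup>2) * (C + H))\<^sup>2 = (C + 3 * H)\<^sup>2 - 8 * S\<^sup>2"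
    and "(cmod (1 + 1 / (cos z)\<^sup>2))\<^sup>2 = 1 + 4 * (C * H + 2) / (C + H)\<^sup>2"
proof -
  have q: "0 < C + H" unfolding C_def H_def by (rule cos_plus_cosh_pos[OF assms(4)])
  have n: "(cmod (cos z))\<^sup>2 = (C + H) / 2" by (simp add: cmod_cos_squared C_def H_def)
  have "1 + 1 / (cos z)\<^sup>2 = (3 + cos (2 * z)) / (2 * (cos z)\<^sup>2)"
    unfolding cos_double_cos using assms(4) by (simp add: field_simps)
  then have "cmod (1 + 1 / (cos z)\<^sup>2) * (C + H) = cmod (3 + cos (2 * z))"
  proof -
    have two: "cmod 2 * ((C + H) / 2) = C + H" by simp
    then show ?thesis
      unfolding \<open>1 + 1 / (cos z)\<^sup>2 = _\<close> norm_divide norm_mult norm_power n two using q by simp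
  qed
  moreover have "(cmod (3 + cos (2 * z)))\<^sup>2 = (3 + C * H)\<^sup>2 + (sin (2 * Re z) * S)\<^sup>2"
    by (simp add: cmod_power2 Re_cos_cosh Im_cos_sinh C_def H_def S_def)
  moreover have "(sin (2 * Re z))\<^sup>2 = 1 - C\<^sup>2" "S\<^sup>2 = H\<^sup>2 - 1"
    by (simp_all add: sin_squared_eq C_def S_def H_def sinh_square_eq)
  ultimately have *: "(cmod (1 + 1 / (cos z)\<^sup>2) * (C + H))\<^sup>2 = (3 + C * H)\<^sup>2 + (1 - C\<^sup>2) * (H\<^sup>2 - 1)"
    and S2: "S\<^sup>2 = H\<^sup>2 - 1"
    by (simp_all add: power_mult_distrib)
  show "(cmod (1 + 1 / (cos z)\<^sup>2) * (C + H))\<^sup>2 = (C + 3 * H)\<^sup>2 - 8 * S\<^sup>2"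
    unfolding * S2 by algebra
  have "(cmod (1 + 1 / (cos z)\<^sup>2))\<^sup>2 * (C + H)\<^sup>2 = (C + H)\<^sup>2 + 4 * (C * H + 2)"
    unfolding power_mult_distrib[symmetric] * by algebra
  then show "(cmod (1 + 1 / (cos z)\<^sup>2))\<^sup>2 = 1 + 4 * (C * H + 2) / (C + H)\<^sup>2"
    using q by (simp add: field_simps)
qed

text \<open>If \<open>Im lam > sqrt 2 + arsinh 1\<close>, then \<open>f\<close> strictly expands the metric \<open>|dz| / |Im z|\<close>.\<close>

lemma half_plane_expansion:
  assumes "Im z < 0"
  shows "- Im (tan_shift lam z) + (Im lam - (sqrt 2 + arsinh 1)) \<le> cmod (1 + 1 / (cos z)\<^sup>2) * - Im z"
proof -
  have nz: "cos z \<noteq> 0" using assms by (intro cos_complex_nonzero) auto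
  define y where "y = - Im z"
  have y: "0 < y" using assms by (simp add: y_def)
  define q where "q = cos (2 * Re z) + cosh (2 * y)"
  have q: "0 < q" using nz by (simp add: cos_complex_nonzero_iff q_def y_def)
  define d where "d = cmod (1 + 1 / (cos z)\<^sup>2)"
  have "(d * q)\<^sup>2 = (q + 2 * cosh (2 * y))\<^sup>2 - 8 * (sinh (2 * y))\<^sup>2"
  proof -
    have "3 * cosh (2 * Im z) + cos (2 * Re z) = cos (2 * Re z) + 3 * cosh (2 * Im z)" by simp
    then show ?thesis
      using tan_shift_derivative_norm(1)[OF nz] by (simp add: d_def q_def y_def add.commute)
  qed
  then have "sqrt ((q + 2 * cosh (2 * y))\<^sup>2 - 8 * (sinh (2 * y))\<^sup>2) = d * q"
    using q by (intro real_sqrt_unique) (simp_all add: d_def)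
  moreover have "(y - (sqrt 2 + arsinh 1)) * q + sinh (2 * y) \<le> y * sqrt ((q + 2 * cosh (2 * y))\<^sup>2 - 8 * (sinh (2 * y))\<^sup>2)"
    using y by (intro half_plane_expansion_real) (auto simp: q_def)
  ultimately have "(y - (sqrt 2 + arsinh 1)) * q + sinh (2 * y) \<le> (d * y) * q" by (simp add: mult_ac)
  then have "((y - (sqrt 2 + arsinh 1)) * q + sinh (2 * y)) / q \<le> d * y"
    using q by (simp add: divide_le_eq)
  moreover have "((y - (sqrt 2 + arsinh 1)) * q + sinh (2 * y)) / q = y - (sqrt 2 + arsinh 1) + sinh (2 * y) / q"
    using q by (simp add: add_divide_distrib)
  ultimately show ?thesis
    using neg_Im_tan_shift[OF nz, of lam] by (simp add: y_def d_def q_def)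
qed

text \<open>The expansion factor 1 + s / y tends to 1 as the depth y of the image grows, so
  expansion alone does not give a contradiction. The orbit, however, returns infinitely often to
  depth at most arsinh 1, and each return gains a fixed factor.\<close>

lemma regular_absorbed_upper:
  assumes lam: "sqrt 2 + arsinh 1 < Im lam" and V: "open V" "connected V"
    and reg: "\<And>z n. z \<in> V \<Longrightarrow> regular lam n z"
  shows "V \<subseteq> basin lam {z. 0 < Im z}"
proof (rule ccontr)
  assume notsub: "\<not> V \<subseteq> basin lam {z. 0 < Im z}"
  have ar: "0 < arsinh (1 :: real)" by simp
  have pos: "0 < Im lam" using lam ar real_sqrt_gt_zero[of 2] by linarith
  interpret escaping_half_plane lam 1 0 "Im lam" by (rule upper_escaping[OF pos])
  have disj: "V \<inter> basin lam {z. 0 < Im z} = {}"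
    using attracted_absorbs[OF V] reg notsub by auto
  obtain z0 where "z0 \<in> V" using notsub by blast
  then obtain r where r: "0 < r" "ball z0 r \<subseteq> V" using V(1) openE by blast
  have neg: "Im ((tan_shift lam ^^ n) z) < 0" if "z \<in> ball z0 r" for z n
    using that r(2) disj reg by (intro not_upper_attracted[OF pos]) auto
  define y where "y = (\<lambda>n. - Im ((tan_shift lam ^^ n) z0))"
  have y: "0 < y n" for n using neg[of z0 n] r(1) by (simp add: y_def)
  \<comment> \<open>Up to the constant factor \<open>y 0\<close>, this is the derivative at
    \<open>z0\<close> of the n-th iterate in the metric |dz| / |Im z|.\<close>
  define E where "E = (\<lambda>n. cmod (multiplier lam n z0) / y n)"
  define s where "s = Im lam - (sqrt 2 + arsinh 1)"
  have s: "0 < s" using lam by (simp add: s_def)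
  have E_nonneg: "0 \<le> E n" for n using y[of n] by (simp add: E_def)
  have bound: "E n \<le> 2 / r" for n
  proof -
    have "cmod (multiplier lam n z0) * r \<le> 2 * y n"
      unfolding y_def using neg reg r by (intro multiplier_bound) auto
    then show ?thesis using y[of n] r(1) by (simp add: E_def field_simps)
  qed
  have step_E: "E n * (1 + s / y (Suc n)) \<le> E (Suc n)" for n
  proof -
    have "(y (Suc n) + s) * cmod (multiplier lam n z0)
        \<le> cmod (1 + 1 / (cos ((tan_shift lam ^^ n) z0))\<^sup>2) * y n * cmod (multiplier lam n z0)"
      using half_plane_expansion[of "(tan_shift lam ^^ n) z0" lam] neg[of z0 n] r(1)
      by (intro mult_right_mono) (auto simp: y_def s_def)
    also have "\<dots> = cmod (multiplier lam (Suc n) z0) * y n"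
      by (simp add: multiplier_def norm_mult)
    finally have "(y (Suc n) + s) * cmod (multiplier lam n z0) / (y n * y (Suc n))
        \<le> cmod (multiplier lam (Suc n) z0) * y n / (y n * y (Suc n))"
      using y[of n] y[of "Suc n"] by (intro divide_right_mono) auto
    then show ?thesis using y[of n] y[of "Suc n"] by (simp add: E_def field_simps)
  qed
  define a where "a = arsinh (1 :: real)"
  have a: "0 < a" "sinh a = 1" "cosh a = sqrt 2" by (simp_all add: a_def cosh_arsinh_real)
  have mono_E: "E m \<le> E n" if "m \<le> n" for m n
  proof (rule lift_Suc_mono_le[OF _ that])
    fix n
    have "E n * 1 \<le> E n * (1 + s / y (Suc n))"
      using E_nonneg[of n] s y[of "Suc n"] by (intro mult_left_mono) auto
    then show "E n \<le> E (Suc n)" using step_E[of n] by simp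
  qed
  \<comment> \<open>At depths above \<open>a\<close> the pull of \<open>tan\<close> is at most coth
    a = sqrt 2 < Im lam, so the depth falls by a fixed amount per step.\<close>
  have recur: "\<exists>n\<ge>N. y n \<le> a" for N
  proof (rule ccontr)
    assume "\<not> (\<exists>n\<ge>N. y n \<le> a)"
    then have big: "a < y n" if "N \<le> n" for n using that by force
    have dec: "y (N + j) \<le> y N - j * (Im lam - sqrt 2)" for j
    proof (induction j)
      case (Suc j)
      define w where "w = (tan_shift lam ^^ (N + j)) z0"
      have w: "y (N + j) = - Im w" "y (N + Suc j) = - Im (tan_shift lam w)" "cos w \<noteq> 0"
        using y[of "N + j"] by (auto simp: y_def w_def intro!: cos_complex_nonzero)
      have "sinh (2 * - Im w) / (cos (2 * Re w) + cosh (2 * - Im w)) \<le> cosh (- Im w) / sinh (- Im w)"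
        using y[of "N + j"] w(1,3) by (intro sinh_cosh_quotient_bounds) (auto simp: cos_complex_nonzero_iff)
      also have "\<dots> \<le> cosh a / sinh a"
        using a(1) big[of "N + j"] w(1) by (intro coth_decreasing) auto
      finally have "y (N + Suc j) \<le> y (N + j) + sqrt 2 - Im lam"
        using neg_Im_tan_shift[OF w(3), of lam] w(1,2) a by simp
      then show ?case using Suc by (simp add: algebra_simps)
    qed simp
    obtain j :: nat where "y N < j * (Im lam - sqrt 2)"
      using reals_Archimedean3[of "Im lam - sqrt 2"] lam ar by auto
    then show False using dec[of j] y[of "N + j"] by linarith
  qed
  \<comment> \<open>The gain belongs to the step arriving at the return time \<open>Suc m\<close>.
    Requiring that time to be at least \<open>Suc n\<close> ensures m >= n, so \<open>E m\<close>
    already carries the earlier gains.\<close>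
  have grow: "\<exists>n. E 0 * (1 + s / a) ^ j \<le> E n" for j
  proof (induction j)
    case (Suc j)
    then obtain n where n: "E 0 * (1 + s / a) ^ j \<le> E n" by blast
    obtain n' where n': "Suc n \<le> n'" "y n' \<le> a" using recur by blast
    then obtain m where m: "n' = Suc m" "n \<le> m" by (metis Suc_le_D Suc_le_mono)
    have "E 0 * (1 + s / a) ^ Suc j = (E 0 * (1 + s / a) ^ j) * (1 + s / a)" by simp
    also have "\<dots> \<le> E m * (1 + s / y (Suc m))"
      using n mono_E[OF m(2)] n'(2) y[of "Suc m"] s a(1) E_nonneg m(1)
      by (intro mult_mono add_left_mono divide_left_mono) auto
    also have "\<dots> \<le> E n'" unfolding m(1) by (rule step_E)
    finally show ?case by blast
  qed (use order_refl in auto)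
  have E0: "0 < E 0" using y[of 0] by (simp add: E_def multiplier_def)
  have "1 < 1 + s / a" using s a(1) by simp
  then obtain j where "(2 / r) / E 0 < (1 + s / a) ^ j" using real_arch_pow by blast
  then have "2 / r < E 0 * (1 + s / a) ^ j" using E0 by (simp only: pos_divide_less_eq mult.commute)
  moreover obtain n where "E 0 * (1 + s / a) ^ j \<le> E n" using grow by blast
  ultimately show False using bound[of n] by linarith
qed

section \<open>No third component when Re lam is a multiple of pi\<close>

lemma basin_backward_funpow:
  assumes "regular lam n z" "(tan_shift lam ^^ n) z \<in> basin lam S"
  shows "z \<in> basin lam S"
proof -
  obtain m where "regular lam m ((tan_shift lam ^^ n) z)" "(tan_shift lam ^^ m) ((tan_shift lam ^^ n) z) \<in> S"
    using assms(2) by (auto simp: basin_def)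
  then have "regular lam (n + m) z" "(tan_shift lam ^^ (n + m)) z \<in> S"
    by (simp_all only: regular_add[OF assms(1)] funpow_add_apply)
  then show ?thesis by (auto simp: basin_def)
qed

lemma tan_shift_funpow_of_int_pi:
  "(tan_shift lam ^^ n) (z + of_int m * of_real pi) = (tan_shift lam ^^ n) z + of_int m * of_real pi"
proof (induction n)
  case (Suc n)
  then show ?case by (simp add: tan_shift_def[of lam "_ + _"] tan_complex_of_int_pi) (simp add: tan_shift_def)
qed simp

lemma basin_half_plane_of_int_pi:
  "z + of_int m * of_real pi \<in> basin lam {z. c < \<sigma> * Im z} \<longleftrightarrow> z \<in> basin lam {z. c < \<sigma> * Im z}"
  by (simp add: basin_def regular_def tan_shift_funpow_of_int_pi sin_cos_complex_of_int_pi)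

text \<open>An orbit avoiding both basins stays in the strip -M <= Im z < 0. Modulo pi it lies in a
  compact set disjoint from the lower basin, which gives one constant K > 1 below |f'| along the
  orbit, while Schwarz-Pick bounds the derivatives of all iterates.\<close>

lemma (in two_baker_domains) regular_absorbed:
  assumes V: "open V" "connected V" and reg: "\<And>z n. z \<in> V \<Longrightarrow> regular lam n z"
  shows "V \<subseteq> basin lam {z. 0 < Im z} \<or> V \<subseteq> lower.attracted"
proof (rule ccontr)
  assume no: "\<not> (V \<subseteq> basin lam {z. 0 < Im z} \<or> V \<subseteq> lower.attracted)"
  interpret upper: escaping_half_plane lam 1 0 "Im lam" by (rule upper_escaping[OF Im_lam(1)])
  have disj: "V \<inter> basin lam {z. 0 < Im z} = {}" "V \<inter> lower.attracted = {}"
    using upper.attracted_absorbs[OF V] lower.attracted_absorbs[OF V] reg no by auto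
  obtain z0 where "z0 \<in> V" using no by blast
  then obtain r where r: "0 < r" "ball z0 r \<subseteq> V" using V(1) openE by blast
  have neg: "Im ((tan_shift lam ^^ n) z) < 0" if "z \<in> ball z0 r" for z n
    using that r(2) disj reg by (intro not_upper_attracted[OF Im_lam(1)]) auto
  have z0: "z0 \<in> ball z0 r" "z0 \<in> V" using r(1) \<open>z0 \<in> V\<close> by auto
  define Z where "Z = (\<lambda>n. (tan_shift lam ^^ n) z0)"
  have Z: "Z n \<notin> lower.attracted" "Im (Z n) < 0" "- M \<le> Im (Z n)" for n
  proof -
    show out: "Z n \<notin> lower.attracted"
      using basin_backward_funpow[OF reg[OF z0(2)], of n] disj z0(2) by (auto simp: Z_def)
    show "Im (Z n) < 0" using neg[OF z0(1)] by (simp add: Z_def)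
    show "- M \<le> Im (Z n)"
    proof -
      have "Z n \<notin> lower.half_plane" by (rule contra_subsetD[OF subset_basin out])
      then show ?thesis by simp
    qed
  qed
  \<comment> \<open>|f'| > 1 off the poles exactly if \<open>\<phi>\<close> > -2. Unlike f',
    \<open>\<phi>\<close> is continuous at the pole contained in \<open>X\<close>, so it attains its
    minimum there.\<close>
  define \<phi> where "\<phi> = (\<lambda>z. cos (2 * Re z) * cosh (2 * Im z))"
  define X where "X = cbox (Complex 0 (- M)) (Complex pi 0) - lower.attracted"
  have X: "z \<in> X \<longleftrightarrow> 0 \<le> Re z \<and> Re z \<le> pi \<and> - M \<le> Im z \<and> Im z \<le> 0 \<and> z \<notin> lower.attracted" for z
    by (auto simp: X_def in_cbox_complex_iff)
  have "compact X" unfolding X_def using lower.open_attracted by (intro compact_diff compact_cbox)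
  have trans: "\<exists>z\<in>X. \<phi> z = \<phi> (Z n)" for n
  proof -
    define m where "m = \<lfloor>Re (Z n) / pi\<rfloor>"
    define z where "z = Z n + of_int (- m) * of_real pi"
    have "of_int m \<le> Re (Z n) / pi" "Re (Z n) / pi \<le> of_int m + 1" unfolding m_def by linarith+
    then have "0 \<le> Re (Z n) - of_int m * pi" "Re (Z n) - of_int m * pi \<le> pi" by (simp_all add: field_simps)
    moreover have "z \<notin> lower.attracted"
      unfolding z_def basin_half_plane_of_int_pi by (rule Z(1))
    ultimately have "z \<in> X" using Z(2,3)[of n] by (simp add: X z_def less_imp_le)
    moreover have "\<phi> z = \<phi> (Z n)"
      using sin_cos_double_of_int_pi(1)[of "Re (Z n)" m] by (simp add: \<phi>_def z_def)
    ultimately show ?thesis by blast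
  qed
  have "continuous_on X \<phi>" unfolding \<phi>_def by (intro continuous_intros)
  moreover have "X \<noteq> {}" using trans by blast
  ultimately obtain zm where zm: "zm \<in> X" "\<And>z. z \<in> X \<Longrightarrow> \<phi> zm \<le> \<phi> z"
    using continuous_attains_inf[OF \<open>compact X\<close>] by blast
  define e where "e = \<phi> zm + 2"
  \<comment> \<open>The real axis is treated separately because
    \<open>contracting_region_attracted\<close> covers only points below it.\<close>
  have e: "0 < e"
  proof (cases "Im zm = 0")
    case True
    then have "\<phi> zm = cos (2 * Re zm)" by (simp add: \<phi>_def)
    then show ?thesis unfolding e_def using cos_ge_minus_one[of "2 * Re zm"] by linarith
  next
    case False
    then have "Im zm < 0" using zm(1) by (simp add: X)
    then show ?thesis
      using contracting_region_attracted[of zm] zm(1) X[of zm] unfolding e_def \<phi>_def by linarith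
  qed
  \<comment> \<open>|f'|^2 = 1 + 4 (\<phi> + 2) / q^2, with \<phi> + 2 >= e by minimality and q <= 1
    + cosh (2 M) in the strip.\<close>
  define K where "K = sqrt (1 + 4 * e / (1 + cosh (2 * M))\<^sup>2)"
  have "0 < 4 * e / (1 + cosh (2 * M))\<^sup>2"
    using e by (intro divide_pos_pos zero_less_power add_pos_pos) auto
  then have K: "1 < K" by (simp add: K_def)
  have expand: "K \<le> cmod (1 + 1 / (cos (Z n))\<^sup>2)" for n
  proof -
    have nz: "cos (Z n) \<noteq> 0" using Z(2)[of n] by (intro cos_complex_nonzero) auto
    define q where "q = cos (2 * Re (Z n)) + cosh (2 * Im (Z n))"
    have q: "0 < q" unfolding q_def by (rule cos_plus_cosh_pos[OF nz])
    have "cosh (2 * - Im (Z n)) \<le> cosh (2 * M)"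
      using Z(2,3)[of n] M_pos by (subst cosh_real_nonneg_le_iff) auto
    then have "q \<le> 1 + cosh (2 * M)" unfolding q_def by (intro add_mono) auto
    moreover have "e \<le> \<phi> (Z n) + 2" using trans[of n] zm(2) by (force simp: e_def)
    ultimately have "4 * e / (1 + cosh (2 * M))\<^sup>2 \<le> 4 * (\<phi> (Z n) + 2) / q\<^sup>2"
      using e q by (intro frac_le power_mono) auto
    then have "1 + 4 * e / (1 + cosh (2 * M))\<^sup>2 \<le> (cmod (1 + 1 / (cos (Z n))\<^sup>2))\<^sup>2"
      using tan_shift_derivative_norm(2)[OF nz] by (simp add: \<phi>_def q_def)
    then show ?thesis unfolding K_def by (rule real_le_lsqrt[rotated]) simp
  qed
  have "K ^ n \<le> cmod (multiplier lam n z0)" for n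
  proof (induction n)
    case (Suc n)
    then have "K ^ n * K \<le> cmod (multiplier lam n z0) * cmod (1 + 1 / (cos (Z n))\<^sup>2)"
      using expand[of n] K by (intro mult_mono) auto
    then show ?case by (simp add: multiplier_def norm_mult Z_def mult.commute)
  qed (simp add: multiplier_def)
  moreover have "cmod (multiplier lam n z0) * r \<le> 2 * M" for n
  proof -
    have "cmod (multiplier lam n z0) * r \<le> 2 * - Im (Z n)"
      unfolding Z_def using neg reg r by (intro multiplier_bound) auto
    then show ?thesis using Z(3)[of n] by linarith
  qed
  ultimately have "K ^ n \<le> 2 * M / r" for n
    using r(1) by (smt (verit) pos_le_divide_eq)
  moreover obtain n where "2 * M / r < K ^ n" using real_arch_pow[OF K] by blast
  ultimately show False by (meson not_le)
qed

subsection \<open>Fatou components and the Julia set\<close>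

lemma open_fatou_set: "open (fatou_set (tan_map lam))"
proof (subst open_subopen, rule ballI)
  fix z assume "z \<in> fatou_set (tan_map lam)"
  then obtain V where "open V \<and> z \<in> V \<and> V \<subseteq> fatou_set (tan_map lam)"
    using fatou_set_regular by metis
  then show "\<exists>V. open V \<and> z \<in> V \<and> V \<subseteq> fatou_set (tan_map lam)" by (rule exI)
qed

lemma fatou_set_funpow_regular: "z \<in> fatou_set (tan_map lam) \<Longrightarrow> regular lam n z"
  using fatou_set_regular by metis

section \<open>Fatou components meeting a basin\<close>

context escaping_half_plane
begin

lemma fatou_component_attracted:
  assumes C: "C \<in> components (fatou_set (tan_map lam))" and "C \<inter> attracted \<noteq> {}"
  shows "C \<subseteq> attracted"
proof (rule attracted_absorbs[OF _ _ _ assms(2)])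
  show "open C" using C open_fatou_set open_components by blast
  show "connected C" using C by (rule in_components_connected)
  show "regular lam n z" if "z \<in> C" for z n
    using that in_components_subset[OF C] by (intro fatou_set_funpow_regular) auto
qed

lemma half_plane_component:
  obtains C where "C \<in> components (fatou_set (tan_map lam))" "half_plane \<subseteq> C"
proof -
  have "half_plane \<subseteq> fatou_set (tan_map lam)"
    using subset_basin attracted_subset_fatou by (rule order_trans)
  moreover from this have "fatou_set (tan_map lam) \<noteq> {}" using half_plane_nonempty by blast
  ultimately show thesis
    using exists_component_superset connected_half_plane that by metis
qed

lemma attracted_component:
  assumes "connected attracted"
  shows "attracted \<in> components (fatou_set (tan_map lam))"
proof -
  obtain C where C: "C \<in> components (fatou_set (tan_map lam))" "half_plane \<subseteq> C"
    by (rule half_plane_component)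
  have meet: "C \<inter> attracted \<noteq> {}"
    using C(2) subset_basin[of half_plane lam] half_plane_nonempty by blast
  have "C \<subseteq> attracted" by (rule fatou_component_attracted[OF C(1) meet])
  moreover have "attracted \<subseteq> C"
    by (rule components_maximal[OF C(1) assms attracted_subset_fatou meet])
  ultimately show ?thesis using C(1) by simp
qed

text \<open>Invariance holds because the image of \<open>C\<close> is a connected part of the Fatou
  set and meets \<open>C\<close> in the half-plane; convergence is inherited from the basin.\<close>

lemma half_plane_component_baker:
  assumes C: "C \<in> components (fatou_set (tan_map lam))" "half_plane \<subseteq> C"
  shows "invariant_baker_domain (tan_map lam) C"
proof -
  have "C \<inter> attracted \<noteq> {}"
    using C(2) subset_basin[of half_plane lam] half_plane_nonempty by blast
  then have sub: "C \<subseteq> attracted" by (rule fatou_component_attracted[OF C(1)])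
  have nz: "cos z \<noteq> 0" if "z \<in> C" for z
    using that sub attracted_regular[of z "Suc 0"] by (auto simp: regular_Suc)
  have "connected (tan_shift lam ` C)"
    using nz by (intro connected_continuous_image in_components_connected[OF C(1)]
        holomorphic_on_imp_continuous_on holomorphic_on_subset[OF tan_shift_holomorphic]) auto
  moreover have "tan_shift lam ` C \<subseteq> fatou_set (tan_map lam)"
    using sub attracted_forward attracted_subset_fatou by blast
  moreover have "C \<inter> tan_shift lam ` C \<noteq> {}"
  proof -
    obtain z where z: "z \<in> half_plane" using half_plane_nonempty by blast
    then have "tan_shift lam z \<in> half_plane" using half_plane_funpow_mem[OF z, of 1] by simp
    then show ?thesis using z C(2) by blast
  qed
  ultimately have "tan_shift lam ` C \<subseteq> C" by (rule components_maximal[OF C(1)])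
  then have "invariant (tan_map lam) C"
    using nz by (auto simp: invariant_def tan_map_def tan_shift_def[symmetric])
  then show ?thesis
    using C(1) sub attracted_uniformly by (auto simp: invariant_baker_domain_def)
qed

end

lemma upper_component:
  assumes "0 < Im lam"
  shows "basin lam {z. 0 < Im z} \<in> fatou_components (tan_map lam)"
    and "primary_component lam = basin lam {z. 0 < Im z}"
proof -
  interpret escaping_half_plane lam 1 0 "Im lam" by (rule upper_escaping[OF assms])
  show *: "basin lam {z. 0 < Im z} \<in> fatou_components (tan_map lam)"
    using attracted_component upper_attracted_connected[OF assms] by simp
  show "primary_component lam = basin lam {z. 0 < Im z}"
    using * subset_basin by (rule primary_component_eqI)
qed

lemma fatou_point_ball:
  assumes "z \<in> fatou_set (tan_map lam)"
  obtains r where "0 < r" "\<And>w n. w \<in> ball z r \<Longrightarrow> regular lam n w"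
proof -
  obtain r where "0 < r" "ball z r \<subseteq> fatou_set (tan_map lam)" using openE[OF open_fatou_set assms] by blast
  then show thesis using that fatou_set_funpow_regular by blast
qed

lemma pole_not_in_fatou_set: "cos p = 0 \<Longrightarrow> p \<notin> fatou_set (tan_map lam)"
  using fatou_set_funpow_regular[of p lam "Suc 0"] by (auto simp: regular_Suc)

lemma pole_real:
  fixes p :: complex
  assumes "cos p = 0"
  shows "Im p = 0" and "cos (2 * Re p) = - 1"
proof -
  show Im: "Im p = 0" using assms cos_complex_nonzero by blast
  show "cos (2 * Re p) = - 1" using assms cmod_cos_squared[of p] by (simp add: Im)
qed

text \<open>f is open, so it maps a small neighbourhood of z onto a neighbourhood of f(z), which
  meets the basin.\<close>

lemma closure_basin_backward:
  assumes "open S" "cos z \<noteq> 0" "tan_shift lam z \<in> closure (basin lam S)"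
  shows "z \<in> closure (basin lam S)"
  unfolding closure_approachable
proof (intro allI impI)
  fix e :: real assume e: "0 < e"
  define V where "V = ball z e \<inter> {z. cos z \<noteq> 0}"
  have "open V" unfolding V_def using open_cos_nonzero by blast
  then have "open (tan_shift lam ` V)" by (rule open_tan_shift_image) (auto simp: V_def)
  moreover have "tan_shift lam z \<in> tan_shift lam ` V" using assms(2) e by (auto simp: V_def)
  ultimately have "tan_shift lam ` V \<inter> basin lam S \<noteq> {}"
    using assms(3) open_Int_closure_eq_empty by blast
  then obtain w where "w \<in> V" "tan_shift lam w \<in> basin lam S" by blast
  then show "\<exists>w\<in>basin lam S. dist w z < e"
    using basin_backward[of w] by (auto simp: V_def dist_commute)
qed

lemma closure_basin_backward_funpow:
  assumes "open S"
  shows "regular lam n z \<Longrightarrow> (tan_shift lam ^^ n) z \<in> closure (basin lam S) \<Longrightarrow> z \<in> closure (basin lam S)"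
proof (induction n arbitrary: z)
  case (Suc n)
  then show ?case
    using closure_basin_backward[OF assms] by (auto simp: regular_Suc_left funpow_swap1)
qed simp

lemma unbounded_poles: "\<exists>p::complex. cos p = 0 \<and> R < cmod p"
proof -
  obtain n :: nat where n: "R < of_nat n * pi" using reals_Archimedean3[OF pi_gt_zero] by blast
  define p where "p = complex_of_real (pi / 2 + of_int (int n) * pi)"
  have "cos p = 0" unfolding p_def by (rule cos_half_pi_plus_of_int_pi)
  moreover have "cmod p = pi / 2 + n * pi"
    unfolding p_def norm_of_real by (simp add: abs_of_nonneg)
  moreover from this have "R < cmod p" using n pi_gt_zero by linarith
  ultimately show ?thesis by blast
qed

section \<open>The Julia set as common boundary of two basins\<close>

context two_baker_domains
begin

abbreviation upper_basin :: "complex set" where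
  "upper_basin \<equiv> basin lam {z. 0 < Im z}"

sublocale upper: escaping_half_plane lam 1 0 "Im lam"
  by (rule upper_escaping[OF Im_lam(1)])

lemma fatou_set_eq: "fatou_set (tan_map lam) = upper_basin \<union> lower.attracted"
proof
  show "fatou_set (tan_map lam) \<subseteq> upper_basin \<union> lower.attracted"
  proof
    fix z assume z: "z \<in> fatou_set (tan_map lam)"
    obtain r where "0 < r" "\<And>w n. w \<in> ball z r \<Longrightarrow> regular lam n w"
      by (rule fatou_point_ball[OF z], rule that)
    then show "z \<in> upper_basin \<union> lower.attracted"
      using regular_absorbed[of "ball z r"] by (metis UnI1 UnI2 centre_in_ball connected_ball open_ball subsetD)
  qed
  show "upper_basin \<union> lower.attracted \<subseteq> fatou_set (tan_map lam)"
    using upper.attracted_subset_fatou lower.attracted_subset_fatou by simp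
qed

lemma basins_disjoint: "upper_basin \<inter> lower.attracted = {}"
proof (rule ccontr)
  assume "upper_basin \<inter> lower.attracted \<noteq> {}"
  then obtain z m n where m: "regular lam m z" "0 < Im ((tan_shift lam ^^ m) z)"
    and n: "regular lam n z" "(tan_shift lam ^^ n) z \<in> lower.half_plane"
    by (auto simp: basin_def)
  have "0 < Im ((tan_shift lam ^^ (m + n)) z)"
    using upper.half_plane_funpow_mem[of "(tan_shift lam ^^ m) z" n] m(2) by (simp add: funpow_add_apply)
  moreover have "(tan_shift lam ^^ (n + m)) z \<in> lower.half_plane"
    using lower.half_plane_funpow_mem[OF n(2), of m] by (simp only: funpow_add_apply)
  ultimately show False using M_pos by (simp add: add.commute)
qed

lemma pole_in_closures:
  assumes "cos p = 0"
  shows "p \<in> closure upper_basin" and "p \<in> closure lower.attracted"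
proof -
  have d: "dist (p + Complex 0 (e / 2)) p < e" "dist (p + Complex 0 (- (e / 2))) p < e" if "0 < e" for e
    using that by (simp_all add: dist_norm complex_norm)
  show "p \<in> closure upper_basin"
    unfolding closure_approachable
  proof (intro allI impI)
    fix e :: real assume e: "0 < e"
    have "p + Complex 0 (e / 2) \<in> upper_basin"
      using e pole_real(1)[OF assms] subset_basin[of "{z. 0 < Im z}" lam] by auto
    then show "\<exists>w\<in>upper_basin. dist w p < e" using d[OF e] by blast
  qed
  show "p \<in> closure lower.attracted"
    unfolding closure_approachable
  proof (intro allI impI)
    fix e :: real assume e: "0 < e"
    have "p + Complex 0 (- (e / 2)) \<in> lower.attracted"
      using e pole_real[OF assms] by (intro below_pole_attracted) auto
    then show "\<exists>w\<in>lower.attracted. dist w p < e" using d[OF e] by blast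
  qed
qed

text \<open>If the iterates were all defined on a ball about z, the ball would be absorbed by a
  basin. So points whose orbits hit a pole accumulate at z, and these belong to the closure by
  pulling back \<open>poles\<close>.\<close>

lemma julia_in_closure:
  assumes z: "z \<notin> fatou_set (tan_map lam)" and S: "open S"
    and poles: "\<And>p. cos p = 0 \<Longrightarrow> p \<in> closure (basin lam S)"
  shows "z \<in> closure (basin lam S)"
proof -
  have "z \<in> closure (closure (basin lam S))"
    unfolding closure_approachable[of z "closure (basin lam S)"]
  proof (intro allI impI)
    fix e :: real assume e: "0 < e"
    have "\<exists>w\<in>ball z e. \<exists>n. \<not> regular lam n w"
    proof (rule ccontr)
      assume "\<not> ?thesis"
      then have "ball z e \<subseteq> upper_basin \<or> ball z e \<subseteq> lower.attracted"
        by (intro regular_absorbed) auto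
      then show False using z e unfolding fatou_set_eq by (meson UnCI centre_in_ball subsetD)
    qed
    then obtain w n where w: "w \<in> ball z e" "\<not> regular lam n w" by blast
    \<comment> \<open>At this k the k-th iterate is finite and is a pole.\<close>
    then obtain k where k: "regular lam k w" "\<not> regular lam (Suc k) w"
      using ex_least_nat_less[of "\<lambda>n. \<not> regular lam n w" n] by auto
    then have "w \<in> closure (basin lam S)"
      using closure_basin_backward_funpow[OF S k(1)] poles by (auto simp: regular_Suc)
    then show "\<exists>w\<in>closure (basin lam S). dist w z < e" using w(1) by (auto simp: dist_commute)
  qed
  then show ?thesis by simp
qed

lemma connected_complement_fatou: "connected (- fatou_set (tan_map lam))"
proof -
  have J: "- fatou_set (tan_map lam) \<subseteq> closure upper_basin" "- fatou_set (tan_map lam) \<subseteq> closure lower.attracted"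
    using julia_in_closure pole_in_closures upper.open_half_plane lower.open_half_plane by auto
  have "closure upper_basin \<inter> lower.attracted = {}" "upper_basin \<inter> closure lower.attracted = {}"
    using basins_disjoint lower.open_attracted upper.open_attracted
      open_Int_closure_eq_empty[of lower.attracted upper_basin]
      open_Int_closure_eq_empty[of upper_basin lower.attracted] by (auto simp: Int_commute)
  then have "- fatou_set (tan_map lam) = closure upper_basin \<inter> closure lower.attracted"
    using J unfolding fatou_set_eq by blast
  moreover have "connected (closure upper_basin \<inter> closure lower.attracted)"
  proof (rule unicoherentD[OF unicoherent_UNIV])
    show "UNIV = closure upper_basin \<union> closure lower.attracted"
      using J(1) closure_subset[of upper_basin] closure_subset[of lower.attracted]
      unfolding fatou_set_eq by blast
  qed (use upper_attracted_connected[OF Im_lam(1)] lower_attracted_connected connected_imp_connected_closure in auto)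
  ultimately show ?thesis by simp
qed

text \<open>Infinity is a limit of poles, so the Julia set lies between its connected finite part
  and the closure of that part.\<close>

lemma connected_julia_set: "connectedin riemann_sphere (julia_set (tan_map lam))"
proof (rule connectedin_intermediate_closure_of)
  show "connectedin riemann_sphere (Some ` (- fatou_set (tan_map lam)))"
    using connected_complement_fatou
    by (intro connectedin_continuous_map_image[OF continuous_map_Some]) simp
  show "Some ` (- fatou_set (tan_map lam)) \<subseteq> julia_set (tan_map lam)"
    by (auto simp: julia_set_def)
  have "None \<in> riemann_sphere closure_of (Some ` (- fatou_set (tan_map lam)))"
    unfolding in_closure_of
  proof (intro conjI allI impI)
    fix T assume "None \<in> T \<and> openin riemann_sphere T"
    then obtain C where C: "compact C" "T = insert None (Some ` (UNIV - C))"
      by (auto simp: openin_Alexandroff_compactification)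
    obtain R where "\<forall>w\<in>C. cmod w \<le> R" using compact_imp_bounded[OF C(1)] bounded_iff by blast
    moreover obtain p where p: "cos p = 0" "R < cmod p" using unbounded_poles by blast
    ultimately have "Some p \<in> T" using C(2) by fastforce
    then show "\<exists>y. y \<in> Some ` (- fatou_set (tan_map lam)) \<and> y \<in> T"
      using pole_not_in_fatou_set[OF p(1)] by blast
  qed simp
  moreover have "Some ` (- fatou_set (tan_map lam)) \<subseteq> riemann_sphere closure_of (Some ` (- fatou_set (tan_map lam)))"
    by (rule closure_of_subset) auto
  ultimately show "julia_set (tan_map lam) \<subseteq> riemann_sphere closure_of (Some ` (- fatou_set (tan_map lam)))"
    unfolding julia_set_def by (auto simp: image_iff) (metis ComplI image_eqI not_None_eq subsetD)
qed

lemma fatou_components_eq: "fatou_components (tan_map lam) = {upper_basin, lower.attracted}"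
proof
  have u: "upper_basin \<in> fatou_components (tan_map lam)" by (rule upper_component[OF Im_lam(1)])
  have l: "lower.attracted \<in> fatou_components (tan_map lam)"
    by (rule lower.attracted_component[OF lower_attracted_connected])
  show "{upper_basin, lower.attracted} \<subseteq> fatou_components (tan_map lam)" using u l by blast
  show "fatou_components (tan_map lam) \<subseteq> {upper_basin, lower.attracted}"
  proof
    fix C assume C: "C \<in> fatou_components (tan_map lam)"
    then obtain z where "z \<in> C" "z \<in> upper_basin \<union> lower.attracted"
      using in_components_nonempty in_components_subset unfolding fatou_set_eq by blast
    then show "C \<in> {upper_basin, lower.attracted}"
      using components_nonoverlap[OF C u] components_nonoverlap[OF C l] by blast
  qed
qed

end

text \<open>Since tanh tends to 1, some \<open>M\<close> satisfies Im lam < tanh M.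
  \<open>Bt\<close> is the component containing the half-plane below -M; it is identified with the
  whole lower basin only when Re lam is a multiple of pi.\<close>

lemma second_baker_domain:
  assumes "0 < Im lam" "Im lam < 1"
  shows "\<exists>Bt. invariant_baker_domain (tan_map lam) Bt \<and> Bt \<noteq> primary_component lam \<and>
      ((\<exists>k::int. Re lam = of_int k * pi) \<longrightarrow>
         fatou_components (tan_map lam) = {primary_component lam, Bt} \<and>
         connectedin riemann_sphere (julia_set (tan_map lam)))"
proof -
  have "\<forall>\<^sub>F x in at_top. Im lam < tanh (x :: real)"
    by (rule order_tendstoD(1)[OF tanh_real_at_top assms(2)])
  then obtain M :: real where M: "0 \<le> M" "Im lam < tanh M"
    using eventually_happens[OF eventually_conj[OF eventually_ge_at_top[of 0]]] by fastforce
  interpret upper: escaping_half_plane lam 1 0 "Im lam" by (rule upper_escaping[OF assms(1)])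
  interpret lower: escaping_half_plane lam "- 1" M "tanh M - Im lam" by (rule lower_escaping[OF M])
  obtain Bt where Bt: "Bt \<in> fatou_components (tan_map lam)" "lower.half_plane \<subseteq> Bt"
    by (rule lower.half_plane_component)
  have B: "primary_component lam = basin lam {z. 0 < Im z}" by (rule upper_component[OF assms(1)])
  have "lower.half_plane \<inter> upper.attracted = {}"
  proof (rule ccontr)
    assume "lower.half_plane \<inter> upper.attracted \<noteq> {}"
    then obtain z n where "z \<in> lower.half_plane" "0 < Im ((tan_shift lam ^^ n) z)"
      by (auto simp: basin_def)
    then show False using lower.half_plane_funpow_mem[of z n] M(1) by auto
  qed
  then have "Bt \<noteq> primary_component lam"
    using Bt(2) lower.half_plane_nonempty unfolding B by auto
  moreover have "invariant_baker_domain (tan_map lam) Bt"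
    by (rule lower.half_plane_component_baker[OF Bt])
  moreover have "fatou_components (tan_map lam) = {primary_component lam, Bt} \<and>
      connectedin riemann_sphere (julia_set (tan_map lam))"
    if "Re lam = of_int k * pi" for k :: int
  proof -
    interpret two_baker_domains lam M k using assms(1) M(2) that by unfold_locales
    have "Bt = lower.attracted \<or> Bt = upper_basin" using Bt(1) unfolding fatou_components_eq by blast
    then show ?thesis
      using \<open>Bt \<noteq> primary_component lam\<close> connected_julia_set unfolding B fatou_components_eq by blast
  qed
  ultimately show ?thesis by blast
qed

text \<open>The critical points below the real axis have imaginary part \<open>- arsinh 1\<close>.\<close>

lemma frame_in_upper_basin:
  assumes lam: "sqrt 2 + arsinh 1 < Im lam"
    and Im: "- arsinh 1 \<le> Im z" and frame: "cos (2 * Re z) = 1 \<or> Im z = - arsinh 1 \<or> 0 < Im z"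
  shows "z \<in> basin lam {z. 0 < Im z}"
proof (cases "0 < Im z")
  case True
  then show ?thesis by (intro subsetD[OF subset_basin]) simp
next
  case False
  define y where "y = - Im z"
  have ar: "0 < arsinh (1 :: real)" by simp
  have y: "0 \<le> y" "y \<le> arsinh 1" using False Im by (auto simp: y_def)
  have nz: "cos z \<noteq> 0"
  proof (cases "cos (2 * Re z) = 1")
    case True
    then show ?thesis by (simp add: cos_complex_nonzero_iff add_pos_pos)
  next
    case False
    then show ?thesis using frame \<open>\<not> 0 < Im z\<close> ar by (intro cos_complex_nonzero) auto
  qed
  \<comment> \<open>On the vertical lines the left side is y + tanh y < arsinh 1 + 1; at depth
    arsinh 1 it is at most arsinh 1 + coth (arsinh 1) = arsinh 1 + sqrt 2.\<close>
  have "y + sinh (2 * y) / (cos (2 * Re z) + cosh (2 * y)) < Im lam"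
  proof (cases "cos (2 * Re z) = 1")
    case True
    have "1 < sqrt (2 :: real)" by simp
    then have "y + tanh y < Im lam" using y(2) lam tanh_real_lt_1[of y] by linarith
    then show ?thesis using True by (simp add: sinh_double_over_cosh_double)
  next
    case False
    then have "y = arsinh 1" using frame \<open>\<not> 0 < Im z\<close> by (auto simp: y_def)
    moreover have "sinh (2 * y) / (cos (2 * Re z) + cosh (2 * y)) \<le> cosh y / sinh y"
    proof (rule sinh_cosh_quotient_bounds(2))
      show "0 < cos (2 * Re z) + cosh (2 * y)" using nz by (simp add: cos_complex_nonzero_iff y_def)
      show "0 < y" unfolding \<open>y = arsinh 1\<close> by (rule ar)
    qed (use y in simp_all)
    ultimately show ?thesis using lam by (simp add: cosh_arsinh_real)
  qed
  then have "0 < Im (tan_shift lam z)"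
    using neg_Im_tan_shift[OF nz, of lam] by (simp add: y_def)
  then show ?thesis using basin_backward[OF nz] subset_basin[of "{z. 0 < Im z}" lam] by auto
qed

text \<open>The Julia set is disconnected because a rectangle around the pole pi / 2 has its
  boundary in the basin: the interior and the outside are open sets separating that pole from
  infinity.\<close>

lemma single_component:
  assumes "sqrt 2 + arsinh 1 < Im lam"
  shows "fatou_components (tan_map lam) = {primary_component lam}"
    and "\<not> connectedin riemann_sphere (julia_set (tan_map lam))"
proof -
  have ar: "0 < arsinh (1 :: real)" by simp
  have pos: "0 < Im lam" using assms ar real_sqrt_gt_zero[of 2] by linarith
  interpret escaping_half_plane lam 1 0 "Im lam" by (rule upper_escaping[OF pos])
  let ?B = "basin lam {z. 0 < Im z}"
  have B: "?B \<in> fatou_components (tan_map lam)" "primary_component lam = ?B"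
    by (rule upper_component[OF pos])+
  have F: "fatou_set (tan_map lam) = ?B"
  proof
    show "fatou_set (tan_map lam) \<subseteq> ?B"
    proof
      fix z assume z: "z \<in> fatou_set (tan_map lam)"
      obtain r where "0 < r" "\<And>w n. w \<in> ball z r \<Longrightarrow> regular lam n w"
        by (rule fatou_point_ball[OF z], rule that)
      then show "z \<in> ?B"
        using regular_absorbed_upper[OF assms, of "ball z r"] by (metis centre_in_ball connected_ball open_ball subsetD)
    qed
    show "?B \<subseteq> fatou_set (tan_map lam)" using attracted_subset_fatou by simp
  qed
  have "connected ?B" using B(1) by (rule in_components_connected)
  moreover have "?B \<noteq> {}" using B(1) by (rule in_components_nonempty)
  ultimately show "fatou_components (tan_map lam) = {primary_component lam}"
    unfolding F B(2) by (metis components_eq_sing_iff)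
  \<comment> \<open>The vertical sides pass through zeros of \<open>tan\<close> and the bottom
    through a critical point; the top may have any positive height.\<close>
  let ?a = "Complex 0 (- arsinh 1)" and ?b = "Complex pi 1"
  define E1 where "E1 = Some ` box ?a ?b"
  define E2 where "E2 = insert None (Some ` (UNIV - cbox ?a ?b))"
  have "openin riemann_sphere E1" by (simp add: E1_def open_box)
  moreover have "openin riemann_sphere E2"
    unfolding openin_Alexandroff_compactification E2_def
    by (rule disjI2, rule exI[of _ "cbox ?a ?b"]) (simp add: compact_cbox closed_cbox)
  moreover have "julia_set (tan_map lam) \<subseteq> E1 \<union> E2"
  proof
    fix x assume x: "x \<in> julia_set (tan_map lam)"
    show "x \<in> E1 \<union> E2"
    proof (cases x)
      case None
      then show ?thesis by (simp add: E2_def)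
    next
      case (Some z)
      then have "z \<notin> ?B" using x by (auto simp: julia_set_def F)
      then have no: "- arsinh 1 \<le> Im z \<Longrightarrow>
          \<not> (cos (2 * Re z) = 1 \<or> Im z = - arsinh 1 \<or> 0 < Im z)"
        using frame_in_upper_basin[OF assms, of z] by blast
      have "z \<in> box ?a ?b" if z: "z \<in> cbox ?a ?b"
      proof -
        have z': "0 \<le> Re z" "Re z \<le> pi" "- arsinh 1 \<le> Im z" using z by (auto simp: in_cbox_complex_iff)
        have "Re z \<noteq> 0" "Re z \<noteq> pi" using no[OF z'(3)] by auto
        then show ?thesis using z' no[OF z'(3)] by (auto simp: in_box_complex_iff)
      qed
      then show ?thesis by (auto simp: Some E1_def E2_def)
    qed
  qed
  moreover have "E1 \<inter> E2 \<inter> julia_set (tan_map lam) = {}"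
    using box_subset_cbox[of ?a ?b] by (auto simp: E1_def E2_def)
  moreover have "E1 \<inter> julia_set (tan_map lam) \<noteq> {}"
  proof -
    have "complex_of_real (pi / 2) \<in> box ?a ?b" using ar by (simp add: in_box_complex_iff)
    moreover have "complex_of_real (pi / 2) \<notin> fatou_set (tan_map lam)"
      using cos_half_pi_plus_of_int_pi[of 0] by (intro pole_not_in_fatou_set) simp
    ultimately show ?thesis unfolding E1_def julia_set_def by blast
  qed
  moreover have "E2 \<inter> julia_set (tan_map lam) \<noteq> {}"
    by (auto simp: E2_def julia_set_def)
  ultimately show "\<not> connectedin riemann_sphere (julia_set (tan_map lam))"
    unfolding connectedin by blast
qed

theorem theorem1p3:
  fixes lam :: complex and B :: "complex set"
  assumes "Im lam > 0"
    and "B = primary_component lam"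
  shows "(Im lam < 1 \<longrightarrow>
           (\<exists>Bt. invariant_baker_domain (tan_map lam) Bt \<and> Bt \<noteq> B \<and>
              ((\<exists>k::int. Re lam = of_int k * pi) \<longrightarrow>
                 fatou_components (tan_map lam) = {B, Bt} \<and>
                 connectedin riemann_sphere (julia_set (tan_map lam))))) \<and>
         (Im lam > sqrt 2 + arsinh 1 \<longrightarrow>
           fatou_components (tan_map lam) = {B} \<and>
           \<not> connectedin riemann_sphere (julia_set (tan_map lam)))"
  using second_baker_domain[OF assms(1)] single_component[of lam] unfolding assms(2) by blast

end
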